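(* Let $\rho\in(0,\lambda_0)$ and let $X$, $Q$, $\Lambda$, $\Xi$, $\tilde\psi_\alpha$, $\psi_\alpha$ be as in the context. Set $$S=\Phi''_{zz}-U\operatorname{diag}\Bigl(\tfrac{\lambda_1^2}{\mu_1},\dots,\tfrac{\lambda_n^2}{\mu_n}\Bigr)X\operatorname{diag}(\lambda_1,\dots,\lambda_n)\,{}^tU .$$ Then $S$ is a complex symmetric matrix and for every $\alpha\in\mathbb N_0^n$ $$\tilde\psi_\alpha(z)=e^{\langle z,Sz\rangle}\,\Xi^\alpha e^{-\langle z,(S+Q)z\rangle}=e^{\langle z,Sz\rangle}\,\Xi^\alpha\bigl(e^{-\langle z,Sz\rangle}\tilde\psi_0(z)\bigr),$$ that is, $$\psi_\alpha(z)=\frac{e^{\langle z,Sz\rangle}}{\sqrt{(2\rho^2)^{|\alpha|}\alpha!}\,\|\tilde\psi_0\|_{\mathscr H_\Phi(\mathbb C^n)}}\,\Xi^\alpha e^{-\langle z,(S+Q)z\rangle}=\frac{e^{\langle z,Sz\rangle}}{\sqrt{(2\rho^2)^{|\alpha|}\alpha!}}\,\Xi^\alpha\bigl(e^{-\langle z,Sz\rangle}\psi_0(z)\bigr).$$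
   Context: Let $n\ge 1$. For column vectors $z,\zeta\in\mathbb C^n$ write $\langle z,\zeta\rangle=\sum_{j}z_j\zeta_j$ (bilinear, no conjugation). For a matrix $M$, ${}^tM$ is the transpose, $\overline M$ the entrywise conjugate, $M^*={}^t\overline M$. Fix complex $n\times n$ matrices $A,B,C$ with ${}^tA=A$, $\det B\ne0$, ${}^tC=C$ and $C_I=\frac{C-\overline C}{2\sqrt{-1}}$ positive definite. Set $$\Phi''_{z\bar z}=\tfrac14 BC_I^{-1}B^*,\qquad \Phi''_{zz}=-\tfrac14BC_I^{-1}\,{}^tB-\tfrac{A}{2\sqrt{-1}},\qquad \Phi(z)=\langle z,\Phi''_{z\bar z}\bar z\rangle+\operatorname{Re}\langle z,\Phi''_{zz}z\rangle .$$ $\Phi''_{z\bar z}$ is positive definite Hermitian, $\Phi''_{zz}$ is complex symmetric. $\mathscr H_\Phi(\mathbb C^n)$ is the Hilbert space of entire functions $F$ on $\mathbb C^n$ with $\int|F|^2e^{-2\Phi}L(dz)<\infty$ ($L$ Lebesgue measure), with inner product $(F,G)=\int_{\mathbb C^n}F\overline Ge^{-2\Phi}L(dz)$ and corresponding norm $\|\cdot\|_{\mathscr H_\Phi(\mathbb C^n)}$. The eigenvalues of $\Phi''_{z\bar z}$ (with multiplicity) are $\lambda_1^2,\dots,\lambda_n^2$ with $\lambda_i>0$; $\lambda_0=\min_i\lambda_i$; $U$ is a fixed unitary matrix with $U^*\Phi''_{z\bar z}U=\operatorname{diag}(\lambda_1^2,\dots,\lambda_n^2)$. Fix $\rho\in(0,\lambda_0)$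 and put $\mu_i=\sqrt{\lambda_i^2-\rho^2}>0$. Fix an $n\times n$ unitary matrix $X$ with ${}^tX\operatorname{diag}(\mu_1/\lambda_1,\dots,\mu_n/\lambda_n)=\operatorname{diag}(\mu_1/\lambda_1,\dots,\mu_n/\lambda_n)X$, and define the (complex symmetric) matrix $$Q=[q_{ij}]=-\Phi''_{zz}+U\operatorname{diag}(\mu_1,\dots,\mu_n)X\operatorname{diag}(\lambda_1,\dots,\lambda_n)\,{}^tU .$$ Put $\tilde\psi_0(z)=\exp(-\langle z,Qz\rangle)$ and $\Lambda_i=\frac{\partial}{\partial z_i}+2\sum_j q_{ij}z_j$, acting on entire functions. $\Lambda_i^*$ denotes the adjoint of $\Lambda_i$ in $\mathscr H_\Phi(\mathbb C^n)$, understood as the differential operator: the unique operator of the form $\sum_k a_k\frac{\partial}{\partial z_k}+\sum_k b_kz_k+c$ with complex constants $a_k,b_k,c$ such that $(\Lambda_iF,G)=(F,\Lambda_i^*G)$ for all $F,G\in\mathscr H_\Phi(\mathbb C^n)$ with $z_kF,\ \partial F/\partial z_k,\ z_kG,\ \partial G/\partial z_k\in\mathscr H_\Phi(\mathbb C^n)$ for all $k$. (The $\Lambda_i^*$ commute with each other.) $\Xi={}^t(\Xi_1,\dots,\Xi_n)$ is the principal (first-order derivative) part of $\Lambda^*={}^t(\Lambda_1^*,\dots,\Lambda_n^* )$, namely $$\Xi=(\Phi''_{zz}+Q)^*(\Phi''_{z\bar z})^{-1}\frac{\partial}{\partial z},\qquad \Xi_i=\sum_{j,k=1}^n(\overline{\gamma_{ij}}+\overline{q_{ij}})\beta_{jk}\frac{\partial}{\partial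 z_k},$$ where $\Phi''_{zz}=[\gamma_{ij}]$ and $(\Phi''_{z\bar z})^{-1}=[\beta_{ij}]$. For $\alpha\in\mathbb N_0^n$, $|\alpha|=\sum\alpha_i$, $\alpha!=\prod\alpha_i!$, $\Xi^\alpha=\Xi_1^{\alpha_1}\cdots\Xi_n^{\alpha_n}$, $\tilde\psi_\alpha=(\Lambda_1^* )^{\alpha_1}\cdots(\Lambda_n^* )^{\alpha_n}\tilde\psi_0$ and $\psi_\alpha=\tilde\psi_\alpha\big/\bigl(\sqrt{(2\rho^2)^{|\alpha|}\alpha!}\,\|\tilde\psi_0\|_{\mathscr H_\Phi(\mathbb C^n)}\bigr)$. *)

theory Defs
  imports "HOL-Analysis.Analysis"
begin

section \<open>Complex matrices\<close>

text \<open>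
  The bilinear pairing \<open>\<langle>z, w\<rangle> = (\<Sum>j. z\<^sub>j w\<^sub>j)\<close> (no conjugation) is the library's
  \<^const>\<open>scalar_product\<close>.
\<close>

definition cnj_vec :: "complex^'n \<Rightarrow> complex^'n" where
  "cnj_vec z = (\<chi> i. cnj (z $ i))"

definition ctranspose :: "complex^'n^'m \<Rightarrow> complex^'m^'n" where
  "ctranspose M = (\<chi> i j. cnj (M $ j $ i))"

definition unitary :: "complex^'n^'n \<Rightarrow> bool" where
  "unitary M \<longleftrightarrow> ctranspose M ** M = mat 1 \<and> M ** ctranspose M = mat 1"

definition pos_def :: "complex^'n^'n \<Rightarrow> bool" where
  "pos_def M \<longleftrightarrow> ctranspose M = M \<and>
     (\<forall>z. z \<noteq> 0 \<longrightarrow> 0 < Re (scalar_product (cnj_vec z) (M *v z)))"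

definition diag :: "('n \<Rightarrow> real) \<Rightarrow> complex^'n^'n" where
  "diag d = (\<chi> i j. if i = j then complex_of_real (d i) else 0)"

definition im_part :: "complex^'n^'n \<Rightarrow> complex^'n^'n" where
  "im_part M = (\<chi> i j. (M $ i $ j - cnj (M $ i $ j)) / (2 * \<i>))"


section \<open>The quadratic weight\<close>

definition Phi_zzbar :: "complex^'n^'n \<Rightarrow> complex^'n^'n \<Rightarrow> complex^'n^'n" where
  "Phi_zzbar B C = (1/4) *\<^sub>R (B ** matrix_inv (im_part C) ** ctranspose B)"

definition Phi_zz :: "complex^'n^'n \<Rightarrow> complex^'n^'n \<Rightarrow> complex^'n^'n \<Rightarrow> complex^'n^'n" where
  "Phi_zz A B C = - ((1/4) *\<^sub>R (B ** matrix_inv (im_part C) ** transpose B))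
                  - (\<chi> i j. A $ i $ j / (2 * \<i>))"

text \<open>
  The first summand is real because \<^term>\<open>Phi_zzbar B C\<close> is Hermitian; \<^const>\<open>Re\<close> only
  adjusts the type there.
\<close>

definition Phi :: "complex^'n^'n \<Rightarrow> complex^'n^'n \<Rightarrow> complex^'n^'n \<Rightarrow> complex^'n \<Rightarrow> real" where
  "Phi A B C z = Re (scalar_product z (Phi_zzbar B C *v cnj_vec z))
               + Re (scalar_product z (Phi_zz A B C *v z))"


section \<open>Entire functions and the weighted Hilbert space\<close>

text \<open>Complex Frechet differentiability at every point; \<open>g\<close> is the complex gradient.\<close>

definition entire :: "(complex^'n \<Rightarrow> complex) \<Rightarrow> bool" where
  "entire F \<longleftrightarrow> (\<forall>z. \<exists>g. (F has_derivative (\<lambda>v. scalar_product g v)) (at z))"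

definition pd :: "'n \<Rightarrow> (complex^'n \<Rightarrow> complex) \<Rightarrow> complex^'n \<Rightarrow> complex" where
  "pd k F z = deriv (\<lambda>t. F (z + t *s axis k 1)) 0"

definition H_space :: "(complex^'n \<Rightarrow> real) \<Rightarrow> (complex^'n \<Rightarrow> complex) set" where
  "H_space \<phi> = {F. entire F \<and> integrable lborel (\<lambda>z. (cmod (F z))\<^sup>2 * exp (- 2 * \<phi> z))}"

definition H_inner ::
  "(complex^'n \<Rightarrow> real) \<Rightarrow> (complex^'n \<Rightarrow> complex) \<Rightarrow> (complex^'n \<Rightarrow> complex) \<Rightarrow> complex" where
  "H_inner \<phi> F G =
     (\<integral>z. F z * cnj (G z) * complex_of_real (exp (- 2 * \<phi> z)) \<partial>lborel)"

definition H_norm :: "(complex^'n \<Rightarrow> real) \<Rightarrow> (complex^'n \<Rightarrow> complex) \<Rightarrow> real" where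
  "H_norm \<phi> F = sqrt (Re (H_inner \<phi> F F))"


section \<open>Differential operators\<close>

type_synonym 'n op = "(complex^'n \<Rightarrow> complex) \<Rightarrow> (complex^'n \<Rightarrow> complex)"

definition first_order_op :: "complex^'n \<Rightarrow> complex^'n \<Rightarrow> complex \<Rightarrow> 'n op" where
  "first_order_op a b c = (\<lambda>F z.
     (\<Sum>k\<in>UNIV. a $ k * pd k F z) + (\<Sum>k\<in>UNIV. b $ k * z $ k) * F z + c * F z)"

definition adjoint_domain :: "(complex^'n \<Rightarrow> real) \<Rightarrow> (complex^'n \<Rightarrow> complex) set" where
  "adjoint_domain \<phi> = {F \<in> H_space \<phi>.
     \<forall>k. (\<lambda>z. z $ k * F z) \<in> H_space \<phi> \<and> pd k F \<in> H_space \<phi>}"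

definition adjoint_op :: "(complex^'n \<Rightarrow> real) \<Rightarrow> 'n op \<Rightarrow> 'n op" where
  "adjoint_op \<phi> L = (THE T. (\<exists>a b c. T = first_order_op a b c) \<and>
     (\<forall>F\<in>adjoint_domain \<phi>. \<forall>G\<in>adjoint_domain \<phi>.
        H_inner \<phi> (L F) G = H_inner \<phi> F (T G)))"

text \<open>
  The operator product \<open>T\<^sub>1\<^sup>\<alpha>\<^sup>1 \<circ> \<dots> \<circ> T\<^sub>n\<^sup>\<alpha>\<^sup>n\<close>, the factors being composed in the order of the index type.
\<close>

definition op_power :: "('n::{finite,linorder} \<Rightarrow> 'n op) \<Rightarrow> ('n \<Rightarrow> nat) \<Rightarrow> 'n op" where
  "op_power T \<alpha> F = foldr (\<lambda>i G. (T i ^^ \<alpha> i) G) (sorted_list_of_set UNIV) F"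

definition Lambda :: "complex^'n^'n \<Rightarrow> 'n \<Rightarrow> 'n op" where
  "Lambda Q i = (\<lambda>F z. pd i F z + 2 * (\<Sum>j\<in>UNIV. Q $ i $ j * z $ j) * F z)"

text \<open>\<open>P\<close> and \<open>R\<close> stand for the mixed and the holomorphic Hessian of the weight.\<close>

definition Xi :: "complex^'n^'n \<Rightarrow> complex^'n^'n \<Rightarrow> complex^'n^'n \<Rightarrow> 'n \<Rightarrow> 'n op" where
  "Xi P R Q i = (\<lambda>F z.
     \<Sum>k\<in>UNIV. (ctranspose (R + Q) ** matrix_inv P) $ i $ k * pd k F z)"

definition psi_tilde0 :: "complex^'n^'n \<Rightarrow> complex^'n \<Rightarrow> complex" where
  "psi_tilde0 Q z = exp (- scalar_product z (Q *v z))"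

definition psi_tilde ::
  "(complex^'n::{finite,linorder} \<Rightarrow> real) \<Rightarrow> complex^'n::_^'n::_ \<Rightarrow> ('n \<Rightarrow> nat) \<Rightarrow>
     complex^'n::_ \<Rightarrow> complex" where
  "psi_tilde \<phi> Q \<alpha> = op_power (\<lambda>i. adjoint_op \<phi> (Lambda Q i)) \<alpha> (psi_tilde0 Q)"

definition normalizer :: "real \<Rightarrow> ('n::finite \<Rightarrow> nat) \<Rightarrow> real" where
  "normalizer \<rho> \<alpha> = sqrt ((2 * \<rho>\<^sup>2) ^ (\<Sum>i\<in>UNIV. \<alpha> i) * (\<Prod>i\<in>UNIV. fact (\<alpha> i)))"

definition psi ::
  "(complex^'n::{finite,linorder} \<Rightarrow> real) \<Rightarrow> complex^'n::_^'n::_ \<Rightarrow> real \<Rightarrow> ('n \<Rightarrow> nat) \<Rightarrow>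
     complex^'n::_ \<Rightarrow> complex" where
  "psi \<phi> Q \<rho> \<alpha> z = psi_tilde \<phi> Q \<alpha> z
     / complex_of_real (normalizer \<rho> \<alpha> * H_norm \<phi> (psi_tilde0 Q))"

end

(*
  By integration by parts each Lambda_i^* is a first-order operator
  Xi_i + (linear form); it is the only candidate because the functions
  p(z) exp <z, Phi_zz z> with p a polynomial all lie in the domain of the
  adjoint and are stable under first-order operators.  Since the diagonal factors
  cancel, (Phi_zz + Q)^* Phi_zzbar^{-1} (Phi_zz - S) = transpose Phi_zzbar, which says
  that the linear form is -Xi_i <z, S z>.  Hence
  Lambda_i^* = exp <z, S z> o Xi_i o exp (- <z, S z>), and powers conjugate likewise.
  Symmetry of S holds because X commutes with diag (mu / lambda): the matrix
  Y = conj X satisfies Y D^2 = D^2 Y, so X is block diagonal with respect to the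
  distinct values of lambda.
*)
theory Submission
  imports Defs "HOL-Probability.Distributions"
begin

section \<open>Entire functions\<close>

text \<open>\<open>adjoint_op\<close> is a definite description, so the candidate must satisfy the
  adjoint identity on all of \<open>adjoint_domain\<close> and be the only one to do so. Elements of
  that domain come with integrability but no pointwise decay; integration by parts therefore rests
  on translation invariance and Fubini instead of boundary terms. With R =
  \<open>Phi_zz A B C\<close> and P = \<open>Phi_zzbar B C\<close>, the exponent of the test
  functions is chosen because |exp <z, R z>|^2 exp (- 2 \<phi>) = exp (- 2 <z, P cnj z>): the
  pluriharmonic part of the weight disappears and a Gaussian remains. The matrix S is found by
  solving the identity for the linear form: R - S = P K^-1 transpose P, where K is the conjugate
  transpose of R + Q. Inserting P = U diag (lam^2) ctranspose U and R + Q = U diag mu X diag lam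
  transpose U gives U diag (lam^2 / mu) X diag lam transpose U, the source of lam^2 / mu. Symmetry
  of S is also what makes 2 S z the gradient of <z, S z>, so the block structure of X enters the
  conjugation itself.\<close>

lemma pd_unique:
  fixes F :: "complex^'n \<Rightarrow> complex"
  assumes "(F has_derivative (\<lambda>v. scalar_product g v)) (at z)"
  shows "pd k F z = g $ k"
proof -
  have l: "((\<lambda>t::complex. z + t *s axis k 1) has_derivative (\<lambda>t. t *s axis k 1)) (at 0)"
  proof -
    have "bounded_linear (\<lambda>t::complex. t *s (axis k 1 :: complex^'n))"
      unfolding linear_conv_bounded_linear[symmetric]
      by (rule linearI) (auto simp: vec_eq_iff algebra_simps)
    then show ?thesis
      by (auto intro!: derivative_eq_intros bounded_linear_imp_has_derivative)
  qed
  have "((\<lambda>t. F (z + t *s axis k 1)) has_derivative (\<lambda>t. scalar_product g (t *s axis k 1))) (at 0)"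
    by (rule has_derivative_compose[OF l]) (use assms in simp)
  moreover have "(\<lambda>t. scalar_product g (t *s axis k 1)) = (*) (g $ k)"
    by (auto simp: scalar_product_def axis_def if_distrib[where f="\<lambda>x. _ * x"] mult.commute cong: if_cong)
  ultimately have "((\<lambda>t. F (z + t *s axis k 1)) has_field_derivative g $ k) (at 0)"
    by (simp add: has_field_derivative_def)
  then show ?thesis by (simp add: pd_def DERIV_imp_deriv)
qed

lemma entire_has_derivative:
  assumes "entire F"
  shows "(F has_derivative (\<lambda>v. \<Sum>k\<in>UNIV. pd k F z * v $ k)) (at z)"
proof -
  obtain g where g: "(F has_derivative (\<lambda>v. scalar_product g v)) (at z)"
    using assms by (auto simp: entire_def)
  then show ?thesis using pd_unique[OF g] by (simp add: scalar_product_def)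
qed

text \<open>The coefficients of a complex-linear derivative are forced by \<open>pd_unique\<close>,
  so one Frechet computation settles both holomorphy and the partials. The closure rules that follow
  are paired for this reason.\<close>

lemma entireI:
  assumes "\<And>z. (F has_derivative (\<lambda>v. \<Sum>k\<in>UNIV. g z k * v $ k)) (at z)"
  shows "entire F" "pd k F z = g z k"
proof -
  have *: "(F has_derivative (\<lambda>v. scalar_product (\<chi> k. g z k) v)) (at z)" for z
    using assms[of z] by (simp add: scalar_product_def)
  then show "entire F" by (auto simp: entire_def)
  show "pd k F z = g z k" using pd_unique[OF *] by simp
qed

lemma entire_continuous: "entire F \<Longrightarrow> continuous_on UNIV F"
  by (intro continuous_at_imp_continuous_on ballI has_derivative_continuous[OF entire_has_derivative])

lemma entire_const: "entire (\<lambda>z. c)" and pd_const [simp]: "pd k (\<lambda>z. c) z = 0"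
proof -
  have "((\<lambda>z. c) has_derivative (\<lambda>v. \<Sum>k\<in>UNIV. 0 * v $ k)) (at z)" for z :: "complex^'a"
    by simp
  from entireI(1)[OF this] show "entire (\<lambda>z::complex^'a. c)" .
  have "((\<lambda>z. c) has_derivative (\<lambda>v. \<Sum>k\<in>UNIV. 0 * v $ k)) (at z)" for z :: "complex^'b"
    by simp
  from entireI(2)[OF this] show "pd k (\<lambda>z::complex^'b. c) z = 0" .
qed

lemma entire_coord: "entire (\<lambda>z::complex^'n. z $ j)"
  and pd_coord: "pd k (\<lambda>z::complex^'n. z $ j) z = (if k = j then 1 else 0)"
proof -
  have "((\<lambda>z. z $ j) has_derivative (\<lambda>v. \<Sum>k\<in>UNIV. (if k = j then 1 else 0) * v $ k)) (at z)"
    for z :: "complex^'n"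
    by (rule bounded_linear_vec_nth[THEN bounded_linear_imp_has_derivative, THEN has_derivative_eq_rhs])
      (auto simp: if_distrib[where f="\<lambda>x. x * _"] cong: if_cong)
  from entireI[OF this] show "entire (\<lambda>z::complex^'n. z $ j)" "pd k (\<lambda>z::complex^'n. z $ j) z = (if k = j then 1 else 0)"
    by auto
qed

lemma entire_add: "entire F \<Longrightarrow> entire G \<Longrightarrow> entire (\<lambda>z. F z + G z)"
  and pd_add: "entire F \<Longrightarrow> entire G \<Longrightarrow> pd k (\<lambda>z. F z + G z) z = pd k F z + pd k G z"
proof -
  assume *: "entire F" "entire G"
  have "((\<lambda>z. F z + G z) has_derivative (\<lambda>v. \<Sum>k\<in>UNIV. (pd k F z + pd k G z) * v $ k)) (at z)" for z
    by (rule has_derivative_add[OF *[THEN entire_has_derivative], THEN has_derivative_eq_rhs])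
      (simp add: sum.distrib algebra_simps)
  from entireI[OF this] show "entire (\<lambda>z. F z + G z)" "pd k (\<lambda>z. F z + G z) z = pd k F z + pd k G z"
    by auto
qed

lemma entire_mult: "entire F \<Longrightarrow> entire G \<Longrightarrow> entire (\<lambda>z. F z * G z)"
  and pd_mult: "entire F \<Longrightarrow> entire G \<Longrightarrow> pd k (\<lambda>z. F z * G z) z = pd k F z * G z + F z * pd k G z"
proof -
  assume *: "entire F" "entire G"
  have "((\<lambda>z. F z * G z) has_derivative
      (\<lambda>v. \<Sum>k\<in>UNIV. (pd k F z * G z + F z * pd k G z) * v $ k)) (at z)" for z
    by (rule has_derivative_mult[OF *[THEN entire_has_derivative], THEN has_derivative_eq_rhs])
      (simp add: sum.distrib sum_distrib_left sum_distrib_right algebra_simps)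
  from entireI[OF this] show "entire (\<lambda>z. F z * G z)"
    "pd k (\<lambda>z. F z * G z) z = pd k F z * G z + F z * pd k G z"
    by auto
qed

lemma entire_exp: "entire F \<Longrightarrow> entire (\<lambda>z. exp (F z))"
  and pd_exp: "entire F \<Longrightarrow> pd k (\<lambda>z. exp (F z)) z = pd k F z * exp (F z)"
proof -
  assume *: "entire F"
  have e: "(exp has_derivative (\<lambda>v. exp x * v)) (at x)" for x :: complex
    using DERIV_exp[of x] by (simp add: has_field_derivative_def)
  have "((\<lambda>z. exp (F z)) has_derivative (\<lambda>v. \<Sum>k\<in>UNIV. (pd k F z * exp (F z)) * v $ k)) (at z)" for z
    by (rule has_derivative_compose[OF entire_has_derivative[OF *] e, THEN has_derivative_eq_rhs])
      (simp add: sum_distrib_left algebra_simps)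
  from entireI[OF this] show "entire (\<lambda>z. exp (F z))" "pd k (\<lambda>z. exp (F z)) z = pd k F z * exp (F z)"
    by auto
qed

lemma entire_cmult: "entire F \<Longrightarrow> entire (\<lambda>z. c * F z)"
  and pd_cmult: "entire F \<Longrightarrow> pd k (\<lambda>z. c * F z) z = c * pd k F z"
  using entire_mult[OF entire_const] pd_mult[OF entire_const] by simp_all

lemma entire_sum: "(\<And>i. i \<in> I \<Longrightarrow> entire (F i)) \<Longrightarrow> entire (\<lambda>z. \<Sum>i\<in>I. F i z)"
  by (induction I rule: infinite_finite_induct) (auto intro: entire_const entire_add)

lemma pd_sum: "(\<And>i. i \<in> I \<Longrightarrow> entire (F i)) \<Longrightarrow> pd k (\<lambda>z. \<Sum>i\<in>I. F i z) z = (\<Sum>i\<in>I. pd k (F i) z)"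
  by (induction I rule: infinite_finite_induct) (auto simp: pd_add entire_sum)

lemmas entire_intros = entire_const entire_coord entire_add entire_mult entire_exp entire_cmult entire_sum

section \<open>Polynomials\<close>

text \<open>Generated by closure instead of by coefficients: holomorphy, stability under
  \<open>pd\<close> and the growth bound are all plain inductions over these four rules.\<close>

inductive_set polyfun :: "(complex^'n \<Rightarrow> complex) set" where
  const: "(\<lambda>z. c) \<in> polyfun"
| coord: "(\<lambda>z. z $ j) \<in> polyfun"
| add: "p \<in> polyfun \<Longrightarrow> q \<in> polyfun \<Longrightarrow> (\<lambda>z. p z + q z) \<in> polyfun"
| mult: "p \<in> polyfun \<Longrightarrow> q \<in> polyfun \<Longrightarrow> (\<lambda>z. p z * q z) \<in> polyfun"

lemma polyfun_entire: "p \<in> polyfun \<Longrightarrow> entire p"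
  by (induction rule: polyfun.induct) (auto intro: entire_intros)

lemma polyfun_pd: "p \<in> polyfun \<Longrightarrow> pd k p \<in> polyfun"
proof (induction rule: polyfun.induct)
  case (const c)
  have "pd k (\<lambda>z. c) = (\<lambda>z. 0)" by auto
  then show ?case by (simp add: polyfun.const)
next
  case (coord j)
  have "pd k (\<lambda>z. z $ j) = (\<lambda>z. if k = j then 1 else 0)" by (auto simp: pd_coord)
  then show ?case by (simp only: polyfun.const)
next
  case (add p q)
  have "pd k (\<lambda>z. p z + q z) = (\<lambda>z. pd k p z + pd k q z)" by (auto simp: pd_add polyfun_entire add)
  then show ?case using add by (simp add: polyfun.add)
next
  case (mult p q)
  have "pd k (\<lambda>z. p z * q z) = (\<lambda>z. pd k p z * q z + p z * pd k q z)"
    by (auto simp: pd_mult polyfun_entire mult)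
  then show ?case using mult by (simp add: polyfun.add polyfun.mult)
qed

lemma polyfun_sum: "(\<And>i. i \<in> I \<Longrightarrow> F i \<in> polyfun) \<Longrightarrow> (\<lambda>z. \<Sum>i\<in>I. F i z) \<in> polyfun"
  by (induction I rule: infinite_finite_induct) (auto intro: polyfun.intros)

lemma polyfun_quadratic: "(\<lambda>z. scalar_product z (M *v z)) \<in> polyfun"
  unfolding scalar_product_def matrix_vector_mult_def
  by (auto intro!: polyfun.intros polyfun_sum)

lemma pd_quadratic:
  assumes "transpose M = M"
  shows "pd k (\<lambda>z. scalar_product z (M *v z)) z = 2 * (M *v z) $ k"
proof -
  have s: "M $ i $ j = M $ j $ i" for i j
    using arg_cong[OF assms, of "\<lambda>M. M $ j $ i"] by (simp add: transpose_def)
  have "pd k (\<lambda>z. scalar_product z (M *v z)) z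
      = (\<Sum>i\<in>UNIV. (if k = i then 1 else 0) * (\<Sum>j\<in>UNIV. M $ i $ j * z $ j)
          + z $ i * (\<Sum>j\<in>UNIV. M $ i $ j * (if k = j then 1 else 0)))"
    by (simp add: scalar_product_def matrix_vector_mult_def pd_sum pd_mult pd_cmult pd_coord entire_intros)
  also have "\<dots> = (\<Sum>j\<in>UNIV. M $ k $ j * z $ j) + (\<Sum>i\<in>UNIV. z $ i * M $ i $ k)"
    by (simp add: sum.distrib if_distrib[where f="\<lambda>x. x * _"] if_distrib[where f="\<lambda>x. _ * x"] cong: if_cong)
  also have "\<dots> = 2 * (M *v z) $ k"
    by (simp add: matrix_vector_mult_def s[of _ k] mult.commute)
  finally show ?thesis .
qed

text \<open>The exponent is a parameter because two are used: <z, R z> for the test functions that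
  determine the adjoint, and - <z, Q z> for the iterates starting from
  \<open>psi_tilde0 Q\<close>.\<close>

definition poly_exp :: "(complex^'n \<Rightarrow> complex) \<Rightarrow> (complex^'n \<Rightarrow> complex) set" where
  "poly_exp q = {\<lambda>z. p z * exp (q z) | p. p \<in> polyfun}"

lemma poly_expI: "p \<in> polyfun \<Longrightarrow> (\<lambda>z. p z * exp (q z)) \<in> poly_exp q"
  by (auto simp: poly_exp_def)

lemma exp_in_poly_exp: "(\<lambda>z. exp (q z)) \<in> poly_exp q"
  using poly_expI[OF polyfun.const[of 1], of q] by simp

lemma poly_exp_mult:
  assumes "p \<in> polyfun" "F \<in> poly_exp q"
  shows "(\<lambda>z. p z * F z) \<in> poly_exp q"
proof -
  obtain r where r: "r \<in> polyfun" "F = (\<lambda>z. r z * exp (q z))" using assms by (auto simp: poly_exp_def)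
  from poly_expI[OF polyfun.mult[OF assms(1) r(1)], of q] show ?thesis by (simp add: r mult.assoc)
qed

lemma poly_exp_add:
  assumes "F \<in> poly_exp q" "G \<in> poly_exp q"
  shows "(\<lambda>z. F z + G z) \<in> poly_exp q"
proof -
  obtain r s where r: "r \<in> polyfun" "F = (\<lambda>z. r z * exp (q z))" and s: "s \<in> polyfun" "G = (\<lambda>z. s z * exp (q z))"
    using assms by (auto simp: poly_exp_def)
  from poly_expI[OF polyfun.add[OF r(1) s(1)], of q] show ?thesis by (simp add: r s distrib_right)
qed

lemma poly_exp_sum:
  "(\<And>i. i \<in> I \<Longrightarrow> F i \<in> poly_exp q) \<Longrightarrow> (\<lambda>z. \<Sum>i\<in>I. F i z) \<in> poly_exp q"
proof (induction I rule: infinite_finite_induct)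
qed (use poly_expI[OF polyfun.const[of 0], of q] in \<open>auto intro: poly_exp_add\<close>)

lemma poly_exp_entire: "q \<in> polyfun \<Longrightarrow> F \<in> poly_exp q \<Longrightarrow> entire F"
  by (auto simp: poly_exp_def intro!: entire_mult[OF _ entire_exp] dest: polyfun_entire)

lemma poly_exp_pd:
  assumes "q \<in> polyfun" "F \<in> poly_exp q"
  shows "pd k F \<in> poly_exp q"
proof -
  obtain p where p: "p \<in> polyfun" "F = (\<lambda>z. p z * exp (q z))" using assms by (auto simp: poly_exp_def)
  have "pd k F = (\<lambda>z. (pd k p z + p z * pd k q z) * exp (q z))"
    using p assms by (auto simp: pd_mult pd_exp polyfun_entire entire_intros algebra_simps)
  then show ?thesis using p assms by (auto intro!: poly_expI polyfun.intros polyfun_pd)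
qed

lemma poly_exp_first_order_op:
  assumes "q \<in> polyfun" "F \<in> poly_exp q"
  shows "first_order_op a b c F \<in> poly_exp q"
  unfolding first_order_op_def
  by (intro poly_exp_add poly_exp_sum poly_exp_mult polyfun.const poly_exp_pd polyfun_sum polyfun.mult
      polyfun.coord assms)

section \<open>Integration over Euclidean space\<close>

lemma
  fixes f :: "'a::euclidean_space \<Rightarrow> 'b::{banach, second_countable_topology}"
  assumes "integrable lborel f"
  shows integrable_lborel_translation: "integrable lborel (\<lambda>x. f (a + x))"
    and integral_lborel_translation: "(\<integral>x. f (a + x) \<partial>lborel) = (\<integral>x. f x \<partial>lborel)"
proof -
  have [measurable]: "f \<in> borel_measurable borel"
    using borel_measurable_integrable[OF assms] by simp
  have "integrable (distr lborel borel ((+) a)) f"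
    using assms by (simp add: lborel_distr_plus)
  then show "integrable lborel (\<lambda>x. f (a + x))"
    by (subst (asm) integrable_distr_eq) auto
  have "(\<integral>x. f x \<partial>lborel) = (\<integral>x. f x \<partial>distr lborel borel ((+) a))"
    by (simp add: lborel_distr_plus)
  also have "\<dots> = (\<integral>x. f (a + x) \<partial>lborel)"
    by (rule integral_distr) auto
  finally show "(\<integral>x. f (a + x) \<partial>lborel) = (\<integral>x. f x \<partial>lborel)" ..
qed

text \<open>Integrate h (v + z) - h z = integral over s in [0, 1] of h' (z + s v) with respect to z.
  The left side gives 0 by translation invariance; after exchanging the integrals, the right side
  gives the integral of h', again by translation invariance.\<close>

lemma integral_directional_derivative_eq_0:
  fixes h :: "'a::euclidean_space \<Rightarrow> 'b::euclidean_space"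
  assumes deriv: "\<And>z. ((\<lambda>t::real. h (z + t *\<^sub>R v)) has_vector_derivative h' z) (at 0)"
    and cont: "continuous_on UNIV h'"
    and h: "integrable lborel h" and h': "integrable lborel h'"
  shows "(\<integral>z. h' z \<partial>lborel) = 0"
proof -
  let ?f = "\<lambda>(s::real) z. indicator {0..1} s *\<^sub>R h' (z + s *\<^sub>R v)"
  have [measurable]: "h' \<in> borel_measurable borel"
    using borel_measurable_integrable[OF h'] by simp
  have shift: "integrable lborel (\<lambda>z. h' (z + a))" "(\<integral>z. h' (z + a) \<partial>lborel) = (\<integral>z. h' z \<partial>lborel)"
    "(\<integral>z. norm (h' (z + a)) \<partial>lborel) = (\<integral>z. norm (h' z) \<partial>lborel)" for a
    using integrable_lborel_translation[OF h', of a] integral_lborel_translation[OF h', of a]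
      integral_lborel_translation[OF integrable_norm[OF h'], of a]
    by (simp_all add: add.commute)
  have inner: "(\<integral>s. ?f s z \<partial>lborel) = h (v + z) - h z" for z
  proof -
    \<comment> \<open>The hypothesis differentiates only at t = 0, but at every base point; rebasing
      at z + s v gives the derivative at s.\<close>
    have d: "((\<lambda>t. h (z + t *\<^sub>R v)) has_vector_derivative h' (z + s *\<^sub>R v)) (at s)" for s :: real
    proof -
      have "((\<lambda>t. h (z + s *\<^sub>R v + t *\<^sub>R v)) has_vector_derivative h' (z + s *\<^sub>R v)) (at (s - s))"
        using deriv[of "z + s *\<^sub>R v"] by simp
      then have "((\<lambda>t. h (z + s *\<^sub>R v + t *\<^sub>R v)) \<circ> (\<lambda>t. t - s) has_vector_derivative
          1 *\<^sub>R h' (z + s *\<^sub>R v)) (at s)"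
        by (intro vector_diff_chain_at) (auto intro!: derivative_eq_intros)
      then show ?thesis by (simp add: o_def algebra_simps)
    qed
    have "(\<integral>s. ?f s z \<partial>lborel) = h (z + 1 *\<^sub>R v) - h (z + 0 *\<^sub>R v)"
      by (rule integral_FTC_atLeastAtMost)
        (auto intro!: has_vector_derivative_at_within[OF d] continuous_on_compose2[OF cont] continuous_intros)
    then show ?thesis by (simp add: add.commute)
  qed
  \<comment> \<open>The integral of the norm over z is the same constant for every s in the unit
    interval, so the indicator makes the double integral finite.\<close>
  have "integrable (lborel \<Otimes>\<^sub>M lborel) (case_prod ?f)"
  proof (rule lborel_pair.Fubini_integrable)
    show "case_prod ?f \<in> borel_measurable (lborel \<Otimes>\<^sub>M lborel)" by measurable
    show "integrable lborel (\<lambda>s. \<integral>z. norm (case_prod ?f (s, z)) \<partial>lborel)"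
      by (simp add: shift)
    show "AE s in lborel. integrable lborel (\<lambda>z. case_prod ?f (s, z))"
      by (auto simp: shift)
  qed
  then have "(\<integral>z. (\<integral>s. ?f s z \<partial>lborel) \<partial>lborel) = (\<integral>s. (\<integral>z. ?f s z \<partial>lborel) \<partial>lborel)"
    by (rule lborel_pair.Fubini_integral)
  also have "(\<integral>s. (\<integral>z. ?f s z \<partial>lborel) \<partial>lborel) = (\<integral>z. h' z \<partial>lborel)"
    by (simp add: shift)
  finally have "(\<integral>z. h' z \<partial>lborel) = (\<integral>z. h (v + z) - h z \<partial>lborel)"
    by (simp add: inner)
  also have "(\<integral>z. h (v + z) - h z \<partial>lborel) = 0"
    using integrable_lborel_translation[OF h, of v] h integral_lborel_translation[OF h, of v] by simp
  finally show ?thesis by simp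
qed

text \<open>The Gaussian factors over the coordinates, and \<open>lborel\<close> is the image of the
  product measure under the coordinate map, which reduces the claim to the normal density on the
  line.\<close>

lemma integrable_gaussian:
  assumes "0 < c"
  shows "integrable lborel (\<lambda>z::'a::euclidean_space. exp (- c * (norm z)\<^sup>2))"
proof -
  interpret product_sigma_finite "\<lambda>b::'a. lborel :: real measure" ..
  \<comment> \<open>The standard deviation for which the exponent x^2 / (2 \<sigma>^2) of the normal
    density equals c x^2.\<close>
  define \<sigma> where "\<sigma> = 1 / sqrt (2 * c)"
  have \<sigma>: "0 < \<sigma>" "2 * \<sigma>\<^sup>2 = 1 / c" using assms by (auto simp: \<sigma>_def power_divide)
  have eq: "exp (- c * x\<^sup>2) = sqrt (2 * pi * \<sigma>\<^sup>2) * normal_density 0 \<sigma> x" for x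
    using \<sigma> assms by (simp add: normal_density_def mult.commute)
  have "integrable lborel (\<lambda>x::real. exp (- c * x\<^sup>2))"
    unfolding eq using \<sigma>(1) by simp
  then have "integrable (\<Pi>\<^sub>M b\<in>Basis. lborel) (\<lambda>x. \<Prod>b\<in>(Basis::'a set). exp (- c * (x b)\<^sup>2))"
    by (intro product_integrable_prod) auto
  also have "(\<lambda>x. \<Prod>b\<in>(Basis::'a set). exp (- c * (x b)\<^sup>2))
      = (\<lambda>x. exp (- c * (norm (\<Sum>b\<in>Basis. x b *\<^sub>R b :: 'a))\<^sup>2))"
  proof
    fix x
    have "(norm (\<Sum>b\<in>Basis. x b *\<^sub>R b :: 'a))\<^sup>2 = (\<Sum>b\<in>(Basis::'a set). (x b)\<^sup>2)"
      unfolding power2_norm_eq_inner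
      by (simp add: inner_sum_left inner_sum_right inner_Basis power2_eq_square
          if_distrib[where f="\<lambda>x. _ * x"] cong: if_cong)
    then show "(\<Prod>b\<in>(Basis::'a set). exp (- c * (x b)\<^sup>2))
        = exp (- c * (norm (\<Sum>b\<in>Basis. x b *\<^sub>R b :: 'a))\<^sup>2)"
      by (simp add: exp_sum[symmetric] sum_distrib_left sum_negf)
  qed
  finally show ?thesis
    by (subst lborel_eq, subst integrable_distr_eq) auto
qed

section \<open>The weighted inner product\<close>

lemma H_space_entire: "F \<in> H_space \<phi> \<Longrightarrow> entire F"
  by (simp add: H_space_def)

text \<open>The pointwise bound x y \<le> x^2 + y^2 stands in for Cauchy-Schwarz and supplies an
  integrable dominating function.\<close>

lemma H_space_integrable:
  assumes \<phi>: "continuous_on UNIV \<phi>" and F: "F \<in> H_space \<phi>" and G: "G \<in> H_space \<phi>"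
  shows "integrable lborel (\<lambda>z. F z * cnj (G z) * complex_of_real (exp (- 2 * \<phi> z)))"
proof (rule Bochner_Integration.integrable_bound)
  show "integrable lborel (\<lambda>z. (cmod (F z))\<^sup>2 * exp (- 2 * \<phi> z) + (cmod (G z))\<^sup>2 * exp (- 2 * \<phi> z))"
    using F G by (simp add: H_space_def)
  have "continuous_on UNIV (\<lambda>z. F z * cnj (G z) * complex_of_real (exp (- 2 * \<phi> z)))"
    by (intro continuous_intros \<phi> entire_continuous H_space_entire[OF F] H_space_entire[OF G])
  then show "(\<lambda>z. F z * cnj (G z) * complex_of_real (exp (- 2 * \<phi> z))) \<in> borel_measurable lborel"
    by (simp add: borel_measurable_continuous_onI)
  have "x * y \<le> x\<^sup>2 + y\<^sup>2" for x y :: real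
    using zero_le_power2[of x] zero_le_power2[of y] zero_le_power2[of "x - y"] unfolding power2_diff
    by linarith
  then have "cmod (F z) * cmod (G z) * exp (- 2 * \<phi> z)
      \<le> ((cmod (F z))\<^sup>2 + (cmod (G z))\<^sup>2) * exp (- 2 * \<phi> z)" for z
    by (rule mult_right_mono) simp
  then show "AE z in lborel. norm (F z * cnj (G z) * complex_of_real (exp (- 2 * \<phi> z)))
      \<le> norm ((cmod (F z))\<^sup>2 * exp (- 2 * \<phi> z) + (cmod (G z))\<^sup>2 * exp (- 2 * \<phi> z))"
    by (auto simp: norm_mult algebra_simps)
qed

lemma H_inner_cnj: "cnj (H_inner \<phi> F G) = H_inner \<phi> G F"
  unfolding H_inner_def by (subst Bochner_Integration.integral_cnj[symmetric]) (simp add: mult_ac)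

lemma H_inner_cmult_left: "H_inner \<phi> (\<lambda>z. c * F z) G = c * H_inner \<phi> F G"
  unfolding H_inner_def by (subst integral_mult_right_zero[symmetric]) (simp add: mult_ac)

lemma H_inner_cmult_right: "H_inner \<phi> F (\<lambda>z. c * G z) = cnj c * H_inner \<phi> F G"
  unfolding H_inner_def by (subst integral_mult_right_zero[symmetric]) (simp add: mult_ac)

lemma H_inner_add_left:
  assumes "continuous_on UNIV \<phi>" "F \<in> H_space \<phi>" "F' \<in> H_space \<phi>" "G \<in> H_space \<phi>"
  shows "H_inner \<phi> (\<lambda>z. F z + F' z) G = H_inner \<phi> F G + H_inner \<phi> F' G"
  unfolding H_inner_def
  by (subst Bochner_Integration.integral_add[symmetric])
    (use assms in \<open>simp_all add: H_space_integrable[simplified] distrib_right\<close>)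

lemma H_space_cmult: "F \<in> H_space \<phi> \<Longrightarrow> (\<lambda>z. c * F z) \<in> H_space \<phi>"
  by (auto simp: H_space_def norm_mult power_mult_distrib mult.assoc entire_cmult)

lemma H_space_add:
  assumes \<phi>: "continuous_on UNIV \<phi>" and F: "F \<in> H_space \<phi>" and G: "G \<in> H_space \<phi>"
  shows "(\<lambda>z. F z + G z) \<in> H_space \<phi>"
proof -
  have e: "entire (\<lambda>z. F z + G z)" using F G by (auto simp: H_space_def entire_add)
  have "integrable lborel (\<lambda>z. (cmod (F z + G z))\<^sup>2 * exp (- 2 * \<phi> z))"
  proof (rule Bochner_Integration.integrable_bound)
    show "integrable lborel (\<lambda>z. 2 * ((cmod (F z))\<^sup>2 * exp (- 2 * \<phi> z)) + 2 * ((cmod (G z))\<^sup>2 * exp (- 2 * \<phi> z)))"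
      using F G by (simp add: H_space_def)
    have "continuous_on UNIV (\<lambda>z. (cmod (F z + G z))\<^sup>2 * exp (- 2 * \<phi> z))"
      by (intro continuous_intros \<phi> entire_continuous H_space_entire[OF F] H_space_entire[OF G])
    then show "(\<lambda>z. (cmod (F z + G z))\<^sup>2 * exp (- 2 * \<phi> z)) \<in> borel_measurable lborel"
      by (simp add: borel_measurable_continuous_onI)
    have "(cmod (F z + G z))\<^sup>2 \<le> 2 * (cmod (F z))\<^sup>2 + 2 * (cmod (G z))\<^sup>2" for z
    proof -
      have "(cmod (F z + G z))\<^sup>2 \<le> (cmod (F z) + cmod (G z))\<^sup>2"
        by (intro power_mono norm_triangle_ineq) simp
      also have "\<dots> \<le> 2 * (cmod (F z))\<^sup>2 + 2 * (cmod (G z))\<^sup>2"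
        using sum_squares_ge_zero[of "cmod (F z) - cmod (G z)" 0]
        by (auto simp: power2_eq_square algebra_simps)
      finally show ?thesis .
    qed
    then have "(cmod (F z + G z))\<^sup>2 * exp (- 2 * \<phi> z)
        \<le> (2 * (cmod (F z))\<^sup>2 + 2 * (cmod (G z))\<^sup>2) * exp (- 2 * \<phi> z)" for z
      by (rule mult_right_mono) simp
    then show "AE z in lborel. norm ((cmod (F z + G z))\<^sup>2 * exp (- 2 * \<phi> z)) \<le>
        norm (2 * ((cmod (F z))\<^sup>2 * exp (- 2 * \<phi> z)) + 2 * ((cmod (G z))\<^sup>2 * exp (- 2 * \<phi> z)))"
      by (auto simp: algebra_simps)
  qed
  with e show ?thesis by (simp add: H_space_def)
qed

lemma H_space_sum:
  assumes \<phi>: "continuous_on UNIV \<phi>" and "finite I" "I \<noteq> {}" and "\<And>i. i \<in> I \<Longrightarrow> F i \<in> H_space \<phi>"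
  shows "(\<lambda>z. \<Sum>i\<in>I. F i z) \<in> H_space \<phi>"
  using assms(2-) by (induction rule: finite_ne_induct) (auto intro: H_space_add[OF \<phi>])

lemma H_inner_sum_left:
  assumes \<phi>: "continuous_on UNIV \<phi>" and "\<And>i. i \<in> I \<Longrightarrow> F i \<in> H_space \<phi>" "G \<in> H_space \<phi>"
  shows "H_inner \<phi> (\<lambda>z. \<Sum>i\<in>I. F i z) G = (\<Sum>i\<in>I. H_inner \<phi> (F i) G)"
  unfolding H_inner_def
  by (subst Bochner_Integration.integral_sum[symmetric])
    (use assms in \<open>simp_all add: H_space_integrable[simplified] sum_distrib_right\<close>)

lemma H_inner_add_right:
  assumes "continuous_on UNIV \<phi>" "F \<in> H_space \<phi>" "G \<in> H_space \<phi>" "G' \<in> H_space \<phi>"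
  shows "H_inner \<phi> F (\<lambda>z. G z + G' z) = H_inner \<phi> F G + H_inner \<phi> F G'"
proof -
  have "cnj (H_inner \<phi> (\<lambda>z. G z + G' z) F) = cnj (H_inner \<phi> G F + H_inner \<phi> G' F)"
    using assms by (simp only: H_inner_add_left)
  then show ?thesis unfolding complex_cnj_add H_inner_cnj .
qed

lemma H_inner_sum_right:
  assumes "continuous_on UNIV \<phi>" "\<And>i. i \<in> I \<Longrightarrow> G i \<in> H_space \<phi>" "F \<in> H_space \<phi>"
  shows "H_inner \<phi> F (\<lambda>z. \<Sum>i\<in>I. G i z) = (\<Sum>i\<in>I. H_inner \<phi> F (G i))"
proof -
  have "cnj (H_inner \<phi> (\<lambda>z. \<Sum>i\<in>I. G i z) F) = cnj (\<Sum>i\<in>I. H_inner \<phi> (G i) F)"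
    using assms by (simp only: H_inner_sum_left)
  then show ?thesis unfolding cnj_sum H_inner_cnj .
qed

text \<open>Zero norm gives F = 0 only almost everywhere; but the set where the continuous F is
  nonzero is open, and a nonempty open set is not negligible. The pointwise conclusion is what
  identifies two candidates for the adjoint.\<close>

lemma H_inner_self_eq_0D:
  assumes \<phi>: "continuous_on UNIV \<phi>" and F: "F \<in> H_space \<phi>" and 0: "H_inner \<phi> F F = 0"
  shows "F z = 0"
proof -
  let ?f = "\<lambda>z. (cmod (F z))\<^sup>2 * exp (- 2 * \<phi> z)"
  have int: "integrable lborel ?f" using F by (simp add: H_space_def)
  have "H_inner \<phi> F F = (\<integral>z. complex_of_real (?f z) \<partial>lborel)"
    unfolding H_inner_def by (simp only: of_real_mult complex_norm_square)
  also have "\<dots> = complex_of_real (\<integral>z. ?f z \<partial>lborel)" by (rule integral_complex_of_real)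
  finally have "(\<integral>z. ?f z \<partial>lborel) = 0" using 0 by (metis of_real_eq_0_iff)
  then have "AE z in lborel. ?f z = 0"
    using integral_nonneg_eq_0_iff_AE[OF int] by simp
  then have "AE z in lborel. z \<notin> {z. F z \<noteq> 0}" by simp
  moreover have op: "open {z. F z \<noteq> 0}"
    using entire_continuous[OF H_space_entire[OF F]] by (intro open_Collect_neq) auto
  ultimately have "{z. F z \<noteq> 0} \<in> null_sets lborel"
    by (subst (asm) AE_iff_null_sets[symmetric]) auto
  then have "negligible {z. F z \<noteq> 0}"
    by (simp add: negligible_iff_null_sets null_sets_completionI)
  then show ?thesis using open_not_negligible[OF op] by auto
qed

section \<open>Quadratic weights\<close>

text \<open>With P and R abstract, the analysis works from P Hermitian and coercive and R symmetric
  alone; \<open>Phi A B C\<close> is the instance P = \<open>Phi_zzbar B C\<close>, R =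
  \<open>Phi_zz A B C\<close>.\<close>

definition quad_weight :: "complex^'n^'n \<Rightarrow> complex^'n^'n \<Rightarrow> complex^'n \<Rightarrow> real" where
  "quad_weight P R z = Re (scalar_product z (P *v cnj_vec z)) + Re (scalar_product z (R *v z))"

text \<open>For Hermitian P and symmetric R this is the Wirtinger derivative of
  \<open>quad_weight P R\<close> in the k-th coordinate.\<close>

definition weight_grad :: "complex^'n^'n \<Rightarrow> complex^'n^'n \<Rightarrow> 'n \<Rightarrow> complex^'n \<Rightarrow> complex" where
  "weight_grad P R k z = (\<Sum>j\<in>UNIV. P $ k $ j * cnj (z $ j)) + (\<Sum>j\<in>UNIV. R $ k $ j * z $ j)"

lemma continuous_quad_weight: "continuous_on UNIV (quad_weight P R)"
  unfolding quad_weight_def[abs_def] scalar_product_def matrix_vector_mult_def cnj_vec_def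
  by (simp) (intro continuous_intros)

text \<open>The product rule yields two terms per form. Hermitian P makes those of the first form
  complex conjugate, hence equal in real part; symmetric R makes those of the second form equal.
  This is the factor 2.\<close>

lemma quad_weight_has_derivative:
  assumes P: "ctranspose P = P" and R: "transpose R = R"
  shows "(quad_weight P R has_derivative
    (\<lambda>v. 2 * Re (\<Sum>k\<in>UNIV. weight_grad P R k z * v $ k))) (at z)"
proof -
  have P': "cnj (P $ i $ j) = P $ j $ i" for i j
    using arg_cong[OF P, of "\<lambda>M. M $ j $ i"] by (simp add: ctranspose_def)
  have R': "R $ i $ j = R $ j $ i" for i j
    using arg_cong[OF R, of "\<lambda>M. M $ j $ i"] by (simp add: transpose_def)
  have n: "((\<lambda>z::complex^'a. z $ i) has_derivative (\<lambda>v. v $ i)) (at z)" for i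
    by (rule bounded_linear_imp_has_derivative[OF bounded_linear_vec_nth])
  have c: "((\<lambda>z::complex^'a. cnj (z $ i)) has_derivative (\<lambda>v. cnj (v $ i))) (at z)" for i
    by (rule bounded_linear.has_derivative[OF bounded_linear_cnj n])
  have "((\<lambda>z. Re (\<Sum>i\<in>UNIV. z $ i * (\<Sum>j\<in>UNIV. P $ i $ j * cnj (z $ j)))
      + Re (\<Sum>i\<in>UNIV. z $ i * (\<Sum>j\<in>UNIV. R $ i $ j * z $ j))) has_derivative
     (\<lambda>v. Re (\<Sum>i\<in>UNIV. z $ i * (\<Sum>j\<in>UNIV. P $ i $ j * cnj (v $ j)) + v $ i * (\<Sum>j\<in>UNIV. P $ i $ j * cnj (z $ j)))
      + Re (\<Sum>i\<in>UNIV. z $ i * (\<Sum>j\<in>UNIV. R $ i $ j * v $ j) + v $ i * (\<Sum>j\<in>UNIV. R $ i $ j * z $ j)))) (at z)"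
    by (intro has_derivative_add bounded_linear.has_derivative[OF bounded_linear_Re] has_derivative_sum
        has_derivative_mult has_derivative_mult_right n c)
  moreover have "Re (\<Sum>i\<in>UNIV. z $ i * (\<Sum>j\<in>UNIV. P $ i $ j * cnj (v $ j)) + v $ i * (\<Sum>j\<in>UNIV. P $ i $ j * cnj (z $ j)))
      + Re (\<Sum>i\<in>UNIV. z $ i * (\<Sum>j\<in>UNIV. R $ i $ j * v $ j) + v $ i * (\<Sum>j\<in>UNIV. R $ i $ j * z $ j))
      = 2 * Re (\<Sum>k\<in>UNIV. weight_grad P R k z * v $ k)" for v
  proof -
    have "(\<Sum>i\<in>UNIV. z $ i * (\<Sum>j\<in>UNIV. P $ i $ j * cnj (v $ j)))
        = cnj (\<Sum>i\<in>UNIV. \<Sum>j\<in>UNIV. cnj (z $ i) * P $ j $ i * v $ j)"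
      by (simp add: P' sum_distrib_left mult.assoc)
    also have "(\<Sum>i\<in>UNIV. \<Sum>j\<in>UNIV. cnj (z $ i) * P $ j $ i * v $ j)
        = (\<Sum>j\<in>UNIV. v $ j * (\<Sum>i\<in>UNIV. P $ j $ i * cnj (z $ i)))"
      by (subst sum.swap) (simp add: sum_distrib_left mult_ac)
    finally have 1: "Re (\<Sum>i\<in>UNIV. z $ i * (\<Sum>j\<in>UNIV. P $ i $ j * cnj (v $ j)))
        = Re (\<Sum>j\<in>UNIV. v $ j * (\<Sum>i\<in>UNIV. P $ j $ i * cnj (z $ i)))"
      by (simp only: cnj.simps)
    have "(\<Sum>i\<in>UNIV. z $ i * (\<Sum>j\<in>UNIV. R $ i $ j * v $ j)) = (\<Sum>j\<in>UNIV. \<Sum>i\<in>UNIV. z $ i * (R $ i $ j * v $ j))"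
      unfolding sum_distrib_left by (rule sum.swap)
    also have "\<dots> = (\<Sum>j\<in>UNIV. v $ j * (\<Sum>i\<in>UNIV. R $ j $ i * z $ i))"
      by (intro sum.cong refl) (simp add: R'[of _ j for j] sum_distrib_left mult_ac)
    finally have 2: "(\<Sum>i\<in>UNIV. z $ i * (\<Sum>j\<in>UNIV. R $ i $ j * v $ j)) = \<dots>" .
    have 3: "(\<Sum>k\<in>UNIV. weight_grad P R k z * v $ k)
      = (\<Sum>j\<in>UNIV. v $ j * (\<Sum>i\<in>UNIV. P $ j $ i * cnj (z $ i))) + (\<Sum>j\<in>UNIV. v $ j * (\<Sum>i\<in>UNIV. R $ j $ i * z $ i))"
      unfolding weight_grad_def distrib_right sum.distrib by (simp add: mult.commute)
    show ?thesis unfolding 3 sum.distrib plus_complex.sel 1 2 by simp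
  qed
  ultimately show ?thesis
    by (simp add: quad_weight_def[abs_def] scalar_product_def matrix_vector_mult_def cnj_vec_def)
qed

section \<open>Integration by parts against the weight\<close>

lemma adjoint_domainD:
  assumes "F \<in> adjoint_domain \<phi>"
  shows "F \<in> H_space \<phi>" "(\<lambda>z. z $ k * F z) \<in> H_space \<phi>" "pd k F \<in> H_space \<phi>"
  using assms by (auto simp: adjoint_domain_def)

lemma has_derivative_imp_vector_derivative_line:
  assumes "(F has_derivative D) (at z)"
  shows "((\<lambda>t::real. F (z + t *\<^sub>R v)) has_vector_derivative D v) (at 0)"
proof -
  have "((\<lambda>t::real. z + t *\<^sub>R v) has_derivative (\<lambda>t. t *\<^sub>R v)) (at 0)"
    by (auto intro!: derivative_eq_intros)
  then have "((\<lambda>t::real. F (z + t *\<^sub>R v)) has_derivative (\<lambda>t. D (t *\<^sub>R v))) (at 0)"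
    by (rule has_derivative_compose) (use assms in simp)
  then show ?thesis
    using linear_scale[OF has_derivative_linear[OF assms]] by (simp add: has_vector_derivative_def)
qed

text \<open>
  The function \<open>cnj \<circ> G\<close> is annihilated by \<open>\<partial>/\<partial>z\<^sub>k\<close>, so integrating
  \<open>\<partial>/\<partial>z\<^sub>k (F \<cdot> cnj G \<cdot> exp (- 2 \<phi>))\<close> leaves only the derivatives of \<open>F\<close> and of the weight.
  The Wirtinger derivative is assembled from the directions \<open>c = 1\<close> and \<open>c = \<i>\<close>.
\<close>

lemma H_inner_pd_left:
  assumes P: "ctranspose P = P" and R: "transpose R = R"
    and F: "F \<in> adjoint_domain (quad_weight P R)" and G: "G \<in> adjoint_domain (quad_weight P R)"
  defines "\<phi> \<equiv> quad_weight P R"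
  shows "H_inner \<phi> (pd k F) G = 2 * (\<Sum>j\<in>UNIV. P $ k $ j * H_inner \<phi> F (\<lambda>z. z $ j * G z))
    + 2 * (\<Sum>j\<in>UNIV. R $ k $ j * H_inner \<phi> (\<lambda>z. z $ j * F z) G)"
proof -
  have cont: "continuous_on UNIV \<phi>" by (simp add: \<phi>_def continuous_quad_weight)
  note F' = adjoint_domainD[OF F, folded \<phi>_def] and G' = adjoint_domainD[OF G, folded \<phi>_def]
  define w where "w z = complex_of_real (exp (- 2 * \<phi> z))" for z
  let ?p = "weight_grad P R k"
  have I: "integrable lborel (\<lambda>z. F1 z * cnj (G1 z) * w z)" if "F1 \<in> H_space \<phi>" "G1 \<in> H_space \<phi>" for F1 G1
    unfolding w_def by (rule H_space_integrable[OF cont that])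
  note cF = entire_continuous[OF H_space_entire[OF F'(1)]] and cG = entire_continuous[OF H_space_entire[OF G'(1)]]
    and cF' = entire_continuous[OF H_space_entire[OF F'(3)]] and cG' = entire_continuous[OF H_space_entire[OF G'(3)]]
  have cw: "continuous_on UNIV w" unfolding w_def by (intro continuous_intros cont)
  have cp: "continuous_on UNIV ?p"
    unfolding weight_grad_def[abs_def] by (intro continuous_intros)
  \<comment> \<open>The conjugate coordinates in the gradient of the weight are moved onto G, so
    every term is a pairing of two elements of \<open>H_space \<phi>\<close>.\<close>
  have p_eq: "F z * cnj (G z) * w z * ?p z =
      (\<Sum>j\<in>UNIV. P $ k $ j * (F z * cnj (z $ j * G z) * w z)) + (\<Sum>j\<in>UNIV. R $ k $ j * (z $ j * F z * cnj (G z) * w z))" for z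
    by (simp add: weight_grad_def sum_distrib_left distrib_left mult_ac)
  have Ip: "integrable lborel (\<lambda>z. F z * cnj (G z) * w z * ?p z)"
    unfolding p_eq
    by (intro Bochner_Integration.integrable_add Bochner_Integration.integrable_sum integrable_mult_right I F' G')
  \<comment> \<open>A real direction sees only the real part of c times the gradient; it is
    dominated by the full product, whose integrability is \<open>Ip\<close>.\<close>
  have Irp: "integrable lborel (\<lambda>z. F z * cnj (G z) * w z * complex_of_real (Re (c * ?p z)))" for c
  proof (rule Bochner_Integration.integrable_bound)
    show "integrable lborel (\<lambda>z. c * (F z * cnj (G z) * w z * ?p z))"
      using Ip by (rule integrable_mult_right)
    have "continuous_on UNIV (\<lambda>z. F z * cnj (G z) * w z * complex_of_real (Re (c * ?p z)))"
      by (intro continuous_intros cF cG cw cp)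
    then show "(\<lambda>z. F z * cnj (G z) * w z * complex_of_real (Re (c * ?p z))) \<in> borel_measurable lborel"
      by (simp add: borel_measurable_continuous_onI)
    show "AE z in lborel. norm (F z * cnj (G z) * w z * complex_of_real (Re (c * ?p z)))
        \<le> norm (c * (F z * cnj (G z) * w z * ?p z))"
    proof (rule AE_I2)
      fix z
      have "norm (F z * cnj (G z) * w z * complex_of_real (Re (c * ?p z)))
          = norm (F z * cnj (G z) * w z) * \<bar>Re (c * ?p z)\<bar>"
        by (simp only: norm_mult norm_of_real)
      also have "\<dots> \<le> norm (F z * cnj (G z) * w z) * norm (c * ?p z)"
        by (intro mult_left_mono abs_Re_le_cmod) simp
      also have "\<dots> = norm (c * (F z * cnj (G z) * w z * ?p z))"
        by (simp only: norm_mult mult_ac)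
      finally show "norm (F z * cnj (G z) * w z * complex_of_real (Re (c * ?p z)))
          \<le> norm (c * (F z * cnj (G z) * w z * ?p z))" .
    qed
  qed
  \<comment> \<open>The derivative of F cnj G w in the direction c times the k-th axis. The
    coefficient - 4 is - 2 from the exponent of w times 2 from the differential of the
    weight.\<close>
  let ?D = "\<lambda>c z. c * (pd k F z * cnj (G z) * w z) + cnj c * (F z * cnj (pd k G z) * w z)
      + (- 4) * (F z * cnj (G z) * w z * complex_of_real (Re (c * ?p z)))"
  have Dint: "(\<integral>z. ?D c z \<partial>lborel) = 0" for c
  proof (rule integral_directional_derivative_eq_0)
    show "integrable lborel (\<lambda>z. F z * cnj (G z) * w z)" by (rule I[OF F'(1) G'(1)])
    show "integrable lborel (?D c)"
      by (intro Bochner_Integration.integrable_add integrable_mult_right I F' G' Irp)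
    show "continuous_on UNIV (?D c)"
      by (intro continuous_intros cF cG cw cp cF' cG')
    fix z
    let ?v = "c *s axis k 1 :: complex^'a"
    have ax: "(\<Sum>j\<in>UNIV. a j * ?v $ j) = a k * c" for a :: "'a \<Rightarrow> complex"
      by (simp add: axis_def if_distrib[where f="\<lambda>x. _ * x"] cong: if_cong)
    have dw: "(w has_derivative (\<lambda>v. w z * complex_of_real (- 4 * Re (\<Sum>k\<in>UNIV. weight_grad P R k z * v $ k)))) (at z)"
    proof -
      have "((\<lambda>z. - 2 * \<phi> z) has_derivative (\<lambda>v. - 2 * (2 * Re (\<Sum>k\<in>UNIV. weight_grad P R k z * v $ k)))) (at z)"
        unfolding \<phi>_def by (intro has_derivative_mult_right quad_weight_has_derivative P R)
      moreover have "(exp has_derivative (\<lambda>v. exp x * v)) (at x)" for x :: real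
        using DERIV_exp[of x] by (simp add: has_field_derivative_def)
      ultimately have "((\<lambda>z. exp (- 2 * \<phi> z)) has_derivative
          (\<lambda>v. exp (- 2 * \<phi> z) * (- 2 * (2 * Re (\<Sum>k\<in>UNIV. weight_grad P R k z * v $ k))))) (at z)"
        by (rule has_derivative_compose)
      then have "((\<lambda>z. complex_of_real (exp (- 2 * \<phi> z))) has_derivative
          (\<lambda>v. complex_of_real (exp (- 2 * \<phi> z) * (- 2 * (2 * Re (\<Sum>k\<in>UNIV. weight_grad P R k z * v $ k)))))) (at z)"
        by (rule bounded_linear.has_derivative[OF bounded_linear_of_real])
      then show ?thesis unfolding w_def by simp
    qed
    have "((\<lambda>z. F z * cnj (G z) * w z) has_derivative
        (\<lambda>v. (F z * cnj (G z)) * (w z * complex_of_real (- 4 * Re (\<Sum>k\<in>UNIV. weight_grad P R k z * v $ k)))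
          + (F z * cnj (\<Sum>k\<in>UNIV. pd k G z * v $ k) + (\<Sum>k\<in>UNIV. pd k F z * v $ k) * cnj (G z)) * w z)) (at z)"
      by (intro has_derivative_mult dw bounded_linear.has_derivative[OF bounded_linear_cnj]
          entire_has_derivative H_space_entire[OF F'(1)] H_space_entire[OF G'(1)])
    from has_derivative_imp_vector_derivative_line[OF this, of ?v]
    show "((\<lambda>t. F (z + t *\<^sub>R ?v) * cnj (G (z + t *\<^sub>R ?v)) * w (z + t *\<^sub>R ?v)) has_vector_derivative ?D c z) (at 0)"
      unfolding ax by (rule has_vector_derivative_eq_rhs) (simp add: algebra_simps)
  qed
  \<comment> \<open>This combination is twice the Wirtinger derivative. The terms with cnj
    (\<open>pd k G z\<close>) cancel because 1 - \<i> cnj \<i> = 0.\<close>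
  have "?D 1 z - \<i> * ?D \<i> z = 2 * (pd k F z * cnj (G z) * w z) - 4 * (F z * cnj (G z) * w z * ?p z)" for z
  proof -
    have "(1 * x + cnj 1 * y + (- 4) * (u * r)) - \<i> * (\<i> * x + cnj \<i> * y + (- 4) * (u * s))
        = 2 * x - 4 * (u * (r - \<i> * s))" for x y u r s :: complex
      by (simp add: algebra_simps)
    moreover have "complex_of_real (Re (1 * ?p z)) - \<i> * complex_of_real (Re (\<i> * ?p z)) = ?p z"
      by (simp add: complex_eq_iff)
    ultimately show ?thesis by (simp only:)
  qed
  then have "(\<integral>z. 2 * (pd k F z * cnj (G z) * w z) - 4 * (F z * cnj (G z) * w z * ?p z) \<partial>lborel)
      = (\<integral>z. ?D 1 z - \<i> * ?D \<i> z \<partial>lborel)" by (simp only:)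
  also have "\<dots> = (\<integral>z. ?D 1 z \<partial>lborel) - (\<integral>z. \<i> * ?D \<i> z \<partial>lborel)"
    by (intro Bochner_Integration.integral_diff Bochner_Integration.integrable_add integrable_mult_right I F' G' Irp)
  also have "\<dots> = 0"
    by (simp only: Dint integral_mult_right_zero) simp
  also have "(\<integral>z. 2 * (pd k F z * cnj (G z) * w z) - 4 * (F z * cnj (G z) * w z * ?p z) \<partial>lborel)
      = 2 * (\<integral>z. pd k F z * cnj (G z) * w z \<partial>lborel) - 4 * (\<integral>z. F z * cnj (G z) * w z * ?p z \<partial>lborel)"
    by (subst Bochner_Integration.integral_diff) (auto intro!: integrable_mult_right Ip I F' G')
  finally have "(\<integral>z. pd k F z * cnj (G z) * w z \<partial>lborel) = 2 * (\<integral>z. F z * cnj (G z) * w z * ?p z \<partial>lborel)"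
    by simp
  also have "(\<integral>z. F z * cnj (G z) * w z * ?p z \<partial>lborel)
      = (\<Sum>j\<in>UNIV. P $ k $ j * (\<integral>z. F z * cnj (z $ j * G z) * w z \<partial>lborel))
        + (\<Sum>j\<in>UNIV. R $ k $ j * (\<integral>z. z $ j * F z * cnj (G z) * w z \<partial>lborel))"
    unfolding p_eq
    by (simp only: Bochner_Integration.integral_add Bochner_Integration.integral_sum
        Bochner_Integration.integrable_sum integrable_mult_right integral_mult_right_zero I F' G')
  finally show ?thesis
    by (simp add: H_inner_def w_def distrib_left)
qed

section \<open>The adjoint\<close>

lemma H_inner_pd_right:
  assumes P: "ctranspose P = P" and R: "transpose R = R"
    and F: "F \<in> adjoint_domain (quad_weight P R)" and G: "G \<in> adjoint_domain (quad_weight P R)"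
  defines "\<phi> \<equiv> quad_weight P R"
  shows "H_inner \<phi> F (pd k G) = 2 * (\<Sum>j\<in>UNIV. cnj (P $ k $ j) * H_inner \<phi> (\<lambda>z. z $ j * F z) G)
    + 2 * (\<Sum>j\<in>UNIV. cnj (R $ k $ j) * H_inner \<phi> F (\<lambda>z. z $ j * G z))"
proof -
  have "cnj (H_inner \<phi> (pd k G) F) = cnj (2 * (\<Sum>j\<in>UNIV. P $ k $ j * H_inner \<phi> G (\<lambda>z. z $ j * F z))
    + 2 * (\<Sum>j\<in>UNIV. R $ k $ j * H_inner \<phi> (\<lambda>z. z $ j * G z) F))"
    unfolding \<phi>_def by (simp only: H_inner_pd_left[OF P R G F])
  then show ?thesis
    by (simp only: complex_cnj_add complex_cnj_mult cnj_sum H_inner_cnj complex_cnj_numeral)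
qed

section \<open>Test functions in the domain of the adjoint, and uniqueness of the adjoint\<close>

lemma polyfun_growth:
  assumes "p \<in> polyfun" "0 < \<epsilon>"
  shows "\<exists>K. \<forall>z. cmod (p z) \<le> K * exp (\<epsilon> * (norm z)\<^sup>2)"
  using assms
proof (induction arbitrary: \<epsilon> rule: polyfun.induct)
  case (const c)
  have "cmod c * 1 \<le> cmod c * exp (\<epsilon> * (norm z)\<^sup>2)" for z :: "complex^'a"
    using const by (intro mult_left_mono) auto
  then show ?case by auto
next
  case (coord j)
  have "cmod (z $ j) \<le> (1 + 1 / \<epsilon>) * exp (\<epsilon> * (norm z)\<^sup>2)" for z :: "complex^'a"
  proof -
    have "cmod (z $ j) \<le> norm z" by (rule Finite_Cartesian_Product.norm_nth_le)
    also have "2 * norm z \<le> 1 + (norm z)\<^sup>2"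
      using zero_le_power2[of "norm z - 1"] by (simp add: power2_diff)
    then have "norm z \<le> 1 + (norm z)\<^sup>2"
      using norm_ge_zero[of z] by linarith
    also have "\<dots> \<le> (1 + 1 / \<epsilon>) * (1 + \<epsilon> * (norm z)\<^sup>2)"
      using coord by (simp add: field_simps)
    also have "\<dots> \<le> (1 + 1 / \<epsilon>) * exp (\<epsilon> * (norm z)\<^sup>2)"
      using coord by (intro mult_left_mono exp_ge_add_one_self) auto
    finally show ?thesis .
  qed
  then show ?case by blast
next
  case (add p q)
  then obtain K L where "\<And>z. cmod (p z) \<le> K * exp (\<epsilon> * (norm z)\<^sup>2)" "\<And>z. cmod (q z) \<le> L * exp (\<epsilon> * (norm z)\<^sup>2)"
    by metis
  then have "cmod (p z + q z) \<le> (K + L) * exp (\<epsilon> * (norm z)\<^sup>2)" for z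
    unfolding distrib_right by (rule norm_triangle_mono)
  then show ?case by blast
next
  \<comment> \<open>The rate was kept arbitrary in the induction for this case: each factor is given
    half of it.\<close>
  case (mult p q)
  then obtain K L where K: "\<And>z. cmod (p z) \<le> K * exp (\<epsilon> / 2 * (norm z)\<^sup>2)"
    and L: "\<And>z. cmod (q z) \<le> L * exp (\<epsilon> / 2 * (norm z)\<^sup>2)"
    using half_gt_zero by meson
  have "cmod (p z * q z) \<le> K * L * exp (\<epsilon> * (norm z)\<^sup>2)" for z
  proof -
    have "cmod (p z * q z) \<le> (K * exp (\<epsilon> / 2 * (norm z)\<^sup>2)) * (L * exp (\<epsilon> / 2 * (norm z)\<^sup>2))"
      unfolding norm_mult using K L by (intro mult_mono') auto
    also have "\<dots> = K * L * (exp (\<epsilon> / 2 * (norm z)\<^sup>2 + \<epsilon> / 2 * (norm z)\<^sup>2))"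
      unfolding exp_add by (simp add: mult_ac)
    also have "\<epsilon> / 2 * (norm z)\<^sup>2 + \<epsilon> / 2 * (norm z)\<^sup>2 = \<epsilon> * (norm z)\<^sup>2" by simp
    finally show ?thesis .
  qed
  then show ?case by blast
qed

text \<open>Positive definiteness with an explicit constant, in the order <z, P cnj z> in which P
  enters the weight; the constant is the rate of the dominating Gaussian.\<close>

definition coercive :: "complex^'n^'n \<Rightarrow> bool" where
  "coercive P \<longleftrightarrow> (\<exists>c>0. \<forall>z. c * (norm z)\<^sup>2 \<le> Re (scalar_product z (P *v cnj_vec z)))"

abbreviation quad_exps :: "complex^'n^'n \<Rightarrow> (complex^'n \<Rightarrow> complex) set" where
  "quad_exps R \<equiv> poly_exp (\<lambda>z. scalar_product z (R *v z))"

text \<open>The form of R cancels against the weight, leaving |p z|^2 exp (- 2 <z, P cnj z>), and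
  coercivity beats the growth of p.\<close>

lemma quad_exps_H_space:
  assumes "coercive P" and F: "F \<in> quad_exps R"
  shows "F \<in> H_space (quad_weight P R)"
proof -
  obtain c where c: "0 < c" "\<And>z. c * (norm z)\<^sup>2 \<le> Re (scalar_product z (P *v cnj_vec z))"
    using assms by (auto simp: coercive_def)
  obtain p where p: "p \<in> polyfun" and F_eq: "F = (\<lambda>z. p z * exp (scalar_product z (R *v z)))"
    using F by (auto simp: poly_exp_def)
  \<comment> \<open>Rate c / 2 becomes c after squaring; the weight contributes - 2 c, so a Gaussian
    of rate c is left.\<close>
  obtain K where K: "\<And>z. cmod (p z) \<le> K * exp (c / 2 * (norm z)\<^sup>2)"
    using polyfun_growth[OF p, of "c / 2"] c by auto
  have ent: "entire F" using F polyfun_quadratic by (rule poly_exp_entire[rotated])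
  have "integrable lborel (\<lambda>z. (cmod (F z))\<^sup>2 * exp (- 2 * quad_weight P R z))"
  proof (rule Bochner_Integration.integrable_bound)
    show "integrable lborel (\<lambda>z::complex^'a. K\<^sup>2 * exp (- c * (norm z)\<^sup>2))"
      by (rule integrable_mult_right) (rule integrable_gaussian[OF c(1)])
    have "continuous_on UNIV (\<lambda>z. (cmod (F z))\<^sup>2 * exp (- 2 * quad_weight P R z))"
      by (intro continuous_intros continuous_quad_weight entire_continuous ent)
    then show "(\<lambda>z. (cmod (F z))\<^sup>2 * exp (- 2 * quad_weight P R z)) \<in> borel_measurable lborel"
      by (simp add: borel_measurable_continuous_onI)
    show "AE z in lborel. norm ((cmod (F z))\<^sup>2 * exp (- 2 * quad_weight P R z)) \<le> norm (K\<^sup>2 * exp (- c * (norm z)\<^sup>2))"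
    proof (rule AE_I2)
      fix z :: "complex^'a"
      let ?r = "Re (scalar_product z (R *v z))" and ?p = "Re (scalar_product z (P *v cnj_vec z))"
      have "(cmod (F z))\<^sup>2 * exp (- 2 * quad_weight P R z)
          = (cmod (p z))\<^sup>2 * (exp ?r * exp ?r * exp (- 2 * (?p + ?r)))"
        by (simp add: F_eq quad_weight_def norm_mult power2_eq_square mult_ac)
      also have "\<dots> = (cmod (p z))\<^sup>2 * exp (- 2 * ?p)"
        by (simp only: exp_add[symmetric]) (simp add: algebra_simps)
      also have "\<dots> \<le> (K * exp (c / 2 * (norm z)\<^sup>2))\<^sup>2 * exp (- 2 * (c * (norm z)\<^sup>2))"
        using K[of z] c(2)[of z] by (intro mult_mono power_mono) auto
      also have "\<dots> = K\<^sup>2 * (exp (c / 2 * (norm z)\<^sup>2) * exp (c / 2 * (norm z)\<^sup>2) * exp (- 2 * (c * (norm z)\<^sup>2)))"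
        by (simp add: power2_eq_square mult_ac)
      also have "\<dots> = K\<^sup>2 * exp (- c * (norm z)\<^sup>2)"
        by (simp only: exp_add[symmetric]) (simp add: algebra_simps)
      finally show "norm ((cmod (F z))\<^sup>2 * exp (- 2 * quad_weight P R z)) \<le> norm (K\<^sup>2 * exp (- c * (norm z)\<^sup>2))"
        by simp
    qed
  qed
  with ent show ?thesis by (simp add: H_space_def)
qed

lemma quad_exps_adjoint_domain:
  assumes "coercive P" and F: "F \<in> quad_exps R"
  shows "F \<in> adjoint_domain (quad_weight P R)"
  using assms by (auto simp: adjoint_domain_def
      intro!: quad_exps_H_space poly_exp_mult polyfun.coord poly_exp_pd polyfun_quadratic)

text \<open>The commutator with multiplication by the j-th coordinate is the scalar
  \<open>a $ j\<close>, read off by evaluating at the origin. Once a vanishes, the operator is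
  multiplication by an affine function, which must then be zero.\<close>

lemma first_order_op_eq_0D:
  assumes R: "transpose R = R" and D: "\<And>G z. G \<in> quad_exps R \<Longrightarrow> first_order_op a b c G z = 0"
  shows "a = 0" "b = 0" "c = 0"
proof -
  define E where "E = (\<lambda>z::complex^'a. exp (scalar_product z (R *v z)))"
  have E: "E \<in> quad_exps R" unfolding E_def by (rule exp_in_poly_exp)
  have entE: "entire E" using polyfun_quadratic E by (rule poly_exp_entire)
  have "a $ j = 0" for j
  proof -
    have "first_order_op a b c (\<lambda>z. z $ j * E z) 0 = a $ j * E 0 + (0::complex^'a) $ j * first_order_op a b c E 0"
      by (simp add: first_order_op_def pd_mult[OF entire_coord entE] pd_coord
          if_distrib[where f="\<lambda>x. _ * x"] if_distrib[where f="\<lambda>x. x * _"] cong: if_cong)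
    then show ?thesis
      using D[OF poly_exp_mult[OF polyfun.coord E]] D[OF E] by (simp add: E_def)
  qed
  then show a: "a = 0" by (simp add: vec_eq_iff)
  have lin: "(\<Sum>k\<in>UNIV. b $ k * z $ k) + c = 0" for z
    using D[OF E, of z] by (simp add: first_order_op_def a E_def flip: distrib_right)
  show c: "c = 0" using lin[of 0] by simp
  have "b $ k = 0" for k
    using lin[of "axis k 1"] c by (simp add: axis_def if_distrib[where f="\<lambda>x. _ * x"] cong: if_cong)
  then show "b = 0" by (simp add: vec_eq_iff)
qed

text \<open>The two conditions come from matching coefficients. Both sides of the adjoint identity
  reduce to the numbers x j = (z_j F, G) and y j = (F, z_j G); equating the x-coefficients gives the
  condition on a, the y-coefficients the one on b.\<close>

lemma adjoint_op_Lambda: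
  assumes P: "ctranspose P = P" and R: "transpose R = R" and co: "coercive P"
    and a: "\<And>j. (\<Sum>k\<in>UNIV. a $ k * P $ k $ j) = cnj ((R + Q) $ i $ j)"
    and b: "\<And>j. b $ j = 2 * cnj (P $ i $ j) - 2 * (\<Sum>k\<in>UNIV. a $ k * R $ k $ j)"
  defines "\<phi> \<equiv> quad_weight P R"
  shows "adjoint_op \<phi> (Lambda Q i) = first_order_op a b 0"
  unfolding adjoint_op_def
proof (rule the_equality)
  have cont: "continuous_on UNIV \<phi>" by (simp add: \<phi>_def continuous_quad_weight)
  have adj: "H_inner \<phi> (Lambda Q i F) G = H_inner \<phi> F (first_order_op a b 0 G)"
    if F: "F \<in> adjoint_domain \<phi>" and G: "G \<in> adjoint_domain \<phi>" for F G
  proof -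
    note F' = adjoint_domainD[OF F] and G' = adjoint_domainD[OF G]
    define x where "x j = H_inner \<phi> (\<lambda>z. z $ j * F z) G" for j
    define y where "y j = H_inner \<phi> F (\<lambda>z. z $ j * G z)" for j
    have "Lambda Q i F = (\<lambda>z. pd i F z + (\<Sum>j\<in>UNIV. (2 * Q $ i $ j) * (z $ j * F z)))"
      by (simp add: Lambda_def sum_distrib_left sum_distrib_right mult_ac)
    then have "H_inner \<phi> (Lambda Q i F) G = H_inner \<phi> (pd i F) G + (\<Sum>j\<in>UNIV. (2 * Q $ i $ j) * x j)"
      by (simp only: x_def H_inner_add_left[OF cont] H_inner_sum_left[OF cont] H_inner_cmult_left
          H_space_sum[OF cont] H_space_cmult F' G' finite UNIV_not_empty not_False_eq_True)
    also have "H_inner \<phi> (pd i F) G = 2 * (\<Sum>j\<in>UNIV. P $ i $ j * y j) + 2 * (\<Sum>j\<in>UNIV. R $ i $ j * x j)"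
      using H_inner_pd_left[OF P R F[unfolded \<phi>_def] G[unfolded \<phi>_def]] by (simp add: \<phi>_def x_def y_def)
    finally have 1: "H_inner \<phi> (Lambda Q i F) G
        = 2 * (\<Sum>j\<in>UNIV. P $ i $ j * y j) + 2 * (\<Sum>j\<in>UNIV. (R + Q) $ i $ j * x j)"
      by (simp add: sum.distrib distrib_right sum_distrib_left mult.assoc)
    have "first_order_op a b 0 G
        = (\<lambda>z. (\<Sum>k\<in>UNIV. a $ k * pd k G z) + (\<Sum>k\<in>UNIV. b $ k * (z $ k * G z)))"
      by (simp add: first_order_op_def sum_distrib_right mult.assoc)
    then have "H_inner \<phi> F (first_order_op a b 0 G)
        = (\<Sum>k\<in>UNIV. cnj (a $ k) * H_inner \<phi> F (pd k G)) + (\<Sum>k\<in>UNIV. cnj (b $ k) * y k)"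
      by (simp only: y_def H_inner_add_right[OF cont] H_inner_sum_right[OF cont] H_inner_cmult_right
          H_space_sum[OF cont] H_space_cmult F' G' finite UNIV_not_empty not_False_eq_True)
    also have "(\<Sum>k\<in>UNIV. cnj (a $ k) * H_inner \<phi> F (pd k G))
        = (\<Sum>k\<in>UNIV. cnj (a $ k) * (2 * (\<Sum>j\<in>UNIV. cnj (P $ k $ j) * x j) + 2 * (\<Sum>j\<in>UNIV. cnj (R $ k $ j) * y j)))"
      using H_inner_pd_right[OF P R F[unfolded \<phi>_def] G[unfolded \<phi>_def]] by (simp add: \<phi>_def x_def y_def)
    also have "\<dots> = 2 * (\<Sum>k\<in>UNIV. \<Sum>j\<in>UNIV. cnj (a $ k) * cnj (P $ k $ j) * x j)
        + 2 * (\<Sum>k\<in>UNIV. \<Sum>j\<in>UNIV. cnj (a $ k) * cnj (R $ k $ j) * y j)"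
      by (simp add: distrib_left sum.distrib sum_distrib_left mult_ac)
    also have "(\<Sum>k\<in>UNIV. \<Sum>j\<in>UNIV. cnj (a $ k) * cnj (P $ k $ j) * x j)
        = (\<Sum>j\<in>UNIV. cnj (\<Sum>k\<in>UNIV. a $ k * P $ k $ j) * x j)"
      by (subst sum.swap) (simp add: sum_distrib_right)
    also have "(\<Sum>k\<in>UNIV. \<Sum>j\<in>UNIV. cnj (a $ k) * cnj (R $ k $ j) * y j)
        = (\<Sum>j\<in>UNIV. cnj (\<Sum>k\<in>UNIV. a $ k * R $ k $ j) * y j)"
      by (subst sum.swap) (simp add: sum_distrib_right)
    finally have "H_inner \<phi> F (first_order_op a b 0 G)
        = 2 * (\<Sum>j\<in>UNIV. (R + Q) $ i $ j * x j)
          + (2 * (\<Sum>j\<in>UNIV. cnj (\<Sum>k\<in>UNIV. a $ k * R $ k $ j) * y j) + (\<Sum>k\<in>UNIV. cnj (b $ k) * y k))"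
      by (simp only: a complex_cnj_cnj add.assoc)
    also have "2 * (\<Sum>j\<in>UNIV. cnj (\<Sum>k\<in>UNIV. a $ k * R $ k $ j) * y j) + (\<Sum>k\<in>UNIV. cnj (b $ k) * y k)
        = 2 * (\<Sum>j\<in>UNIV. P $ i $ j * y j)"
      unfolding sum_distrib_left sum.distrib[symmetric]
      by (intro sum.cong refl) (simp only: b, simp add: algebra_simps)
    finally show ?thesis using 1 by simp
  qed
  then show "(\<exists>a' b' c'. first_order_op a b 0 = first_order_op a' b' c') \<and>
    (\<forall>F\<in>adjoint_domain \<phi>. \<forall>G\<in>adjoint_domain \<phi>.
        H_inner \<phi> (Lambda Q i F) G = H_inner \<phi> F (first_order_op a b 0 G))"
    by blast
  fix T assume T: "(\<exists>a b c. T = first_order_op a b c) \<and> (\<forall>F\<in>adjoint_domain \<phi>. \<forall>G\<in>adjoint_domain \<phi>.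
        H_inner \<phi> (Lambda Q i F) G = H_inner \<phi> F (T G))"
  then obtain a' b' c' where T_eq: "T = first_order_op a' b' c'" by blast
  have "first_order_op (a' - a) (b' - b) c' G z = 0" if G: "G \<in> quad_exps R" for G z
  proof -
    let ?D = "first_order_op (a' - a) (b' - b) c' G"
    have D: "?D \<in> quad_exps R" and T0: "first_order_op a b 0 G \<in> quad_exps R"
      using G polyfun_quadratic by (auto intro: poly_exp_first_order_op)
    have dom: "F \<in> adjoint_domain \<phi>" if "F \<in> quad_exps R" for F
      unfolding \<phi>_def by (rule quad_exps_adjoint_domain[OF co that])
    \<comment> \<open>The difference of the two candidates, applied to G, is itself an admissible
      test function; pairing with it turns the two adjoint identities into a vanishing norm.\<close>
    have "H_inner \<phi> ?D (T G) = H_inner \<phi> ?D (first_order_op a b 0 G)"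
      using T[THEN conjunct2, rule_format, OF dom[OF D] dom[OF G]] adj[OF dom[OF D] dom[OF G]]
      by (simp only:)
    moreover have "T G = (\<lambda>z. ?D z + first_order_op a b 0 G z)"
      by (auto simp: T_eq first_order_op_def sum.distrib sum_subtractf algebra_simps)
    ultimately have "H_inner \<phi> ?D ?D = 0"
      using H_inner_add_right[OF cont, of ?D ?D "first_order_op a b 0 G"] dom[OF D] dom[OF T0]
      by (simp add: adjoint_domainD)
    then show ?thesis
      by (rule H_inner_self_eq_0D[OF cont adjoint_domainD(1)[OF dom[OF D]]])
  qed
  from first_order_op_eq_0D[OF R this] show "T = first_order_op a b 0"
    by (simp add: T_eq)
qed

section \<open>Matrices\<close>

lemma ctranspose_mult: "ctranspose (M ** N) = ctranspose N ** ctranspose M"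
  by (simp add: ctranspose_def matrix_matrix_mult_def vec_eq_iff mult.commute)

lemma ctranspose_ctranspose [simp]: "ctranspose (ctranspose M) = M"
  by (simp add: ctranspose_def vec_eq_iff)

lemma ctranspose_transpose: "ctranspose (transpose M) = transpose (ctranspose M)"
  by (simp add: ctranspose_def transpose_def vec_eq_iff)

lemma ctranspose_diag [simp]: "ctranspose (diag d) = diag d"
  by (auto simp: ctranspose_def diag_def vec_eq_iff)

lemma transpose_diag [simp]: "transpose (diag d) = diag d"
  by (auto simp: transpose_def diag_def vec_eq_iff)

lemma diag_mult_nth: "(diag d ** M) $ i $ j = complex_of_real (d i) * M $ i $ j"
  by (simp add: diag_def matrix_matrix_mult_def if_distrib[where f="\<lambda>x. x * _"] cong: if_cong)

lemma mult_diag_nth: "(M ** diag d) $ i $ j = M $ i $ j * complex_of_real (d j)"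
  by (simp add: diag_def matrix_matrix_mult_def if_distrib[where f="\<lambda>x. _ * x"] cong: if_cong)

lemma diag_mult_diag: "diag d ** diag e = diag (\<lambda>i. d i * e i)"
  by (simp add: vec_eq_iff diag_mult_nth) (simp add: diag_def)

lemma diag_one: "diag (\<lambda>_. 1) = mat 1"
  by (simp add: diag_def mat_def vec_eq_iff)

lemma transpose_eq_iff: "transpose M = M \<longleftrightarrow> (\<forall>i j. M $ i $ j = M $ j $ i)"
  by (auto simp: transpose_def vec_eq_iff)

lemma matrix_inv_inverse:
  fixes M :: "'a::field^'n^'n"
  assumes "invertible M"
  shows "M ** matrix_inv M = mat 1" "matrix_inv M ** M = mat 1"
  using someI_ex[OF assms[unfolded invertible_def]] unfolding matrix_inv_def by auto

lemma matrix_inv_symmetric: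
  fixes M :: "'a::field^'n^'n"
  assumes "invertible M" and M: "transpose M = M"
  shows "transpose (matrix_inv M) = matrix_inv M"
proof -
  note inv = matrix_inv_inverse[OF assms(1)]
  have "transpose (matrix_inv M) ** M = mat 1"
    using arg_cong[OF inv(1), of transpose] M by (simp add: matrix_transpose_mul)
  then have "transpose (matrix_inv M) ** (M ** matrix_inv M) = matrix_inv M"
    by (simp add: matrix_mul_assoc)
  then show ?thesis by (simp add: inv)
qed

lemma pos_def_invertible:
  assumes "pos_def M"
  shows "invertible M"
proof -
  have "z = 0" if "M *v z = 0" for z
  proof (rule ccontr)
    assume "z \<noteq> 0"
    then have "0 < Re (scalar_product (cnj_vec z) (M *v z))" using assms by (auto simp: pos_def_def)
    then show False using that by (simp add: scalar_product_def)
  qed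
  then show ?thesis
    using matrix_left_invertible_ker[of M] invertible_left_inverse[of M] by blast
qed

section \<open>Symmetry and positivity of the Hessians\<close>

lemma Phi_zz_symmetric:
  assumes "transpose A = A" "transpose C = C" "pos_def (im_part C)"
  shows "transpose (Phi_zz A B C) = Phi_zz A B C"
proof -
  have "transpose (im_part C) = im_part C"
    using assms(2) by (auto simp: transpose_eq_iff im_part_def)
  then have "transpose (matrix_inv (im_part C)) = matrix_inv (im_part C)"
    by (intro matrix_inv_symmetric pos_def_invertible assms)
  then have "transpose (B ** matrix_inv (im_part C) ** transpose B) = B ** matrix_inv (im_part C) ** transpose B"
    by (simp add: matrix_transpose_mul matrix_mul_assoc)
  with assms(1) show ?thesis
    by (simp add: Phi_zz_def transpose_eq_iff)
qed

lemma scalar_product_matrix_vector: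
  "scalar_product z (M *v w) = scalar_product (transpose M *v z) (w :: 'a::comm_semiring_1^'n)"
proof -
  have "scalar_product z (M *v w) = (\<Sum>i\<in>UNIV. \<Sum>j\<in>UNIV. z $ i * M $ i $ j * w $ j)"
    by (simp add: scalar_product_def matrix_vector_mult_def sum_distrib_left mult.assoc)
  also have "\<dots> = (\<Sum>j\<in>UNIV. \<Sum>i\<in>UNIV. z $ i * M $ i $ j * w $ j)" by (rule sum.swap)
  also have "\<dots> = scalar_product (transpose M *v z) w"
    by (simp add: scalar_product_def matrix_vector_mult_def transpose_def sum_distrib_left
        sum_distrib_right mult_ac)
  finally show ?thesis .
qed

text \<open>Because the conjugate sits on the second argument, the diagonalising coordinates are
  transpose V z: ctranspose V maps cnj z to the conjugate of that vector.\<close>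

lemma Re_hermitian_form_diag:
  "Re (scalar_product z ((V ** diag d ** ctranspose V) *v cnj_vec z))
    = (\<Sum>l\<in>UNIV. d l * (cmod ((transpose V *v z) $ l))\<^sup>2)"
proof -
  have c: "ctranspose V *v cnj_vec z = cnj_vec (transpose V *v z)"
    by (simp add: vec_eq_iff ctranspose_def transpose_def cnj_vec_def matrix_vector_mult_def)
  have d: "diag d *v w = (\<chi> l. complex_of_real (d l) * w $ l)" for w
    by (simp add: vec_eq_iff diag_def matrix_vector_mult_def if_distrib[where f="\<lambda>x. x * _"] cong: if_cong)
  have "(V ** diag d ** ctranspose V) *v cnj_vec z = V *v (diag d *v (ctranspose V *v cnj_vec z))"
    by (simp only: matrix_vector_mul_assoc matrix_mul_assoc)
  then have "scalar_product z ((V ** diag d ** ctranspose V) *v cnj_vec z)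
      = (\<Sum>l\<in>UNIV. complex_of_real (d l) * ((transpose V *v z) $ l * cnj ((transpose V *v z) $ l)))"
    by (simp add: scalar_product_matrix_vector c d) (simp add: scalar_product_def cnj_vec_def mult_ac)
  also have "\<dots> = complex_of_real (\<Sum>l\<in>UNIV. d l * (cmod ((transpose V *v z) $ l))\<^sup>2)"
    by (simp add: complex_norm_square[symmetric])
  finally show ?thesis by simp
qed

lemma coercive_unitary_diag:
  assumes V: "V ** ctranspose V = mat 1" and d: "\<And>l. c \<le> d l" and c: "0 < c"
  shows "coercive (V ** diag d ** ctranspose V)"
proof -
  have "c * (norm z)\<^sup>2 \<le> Re (scalar_product z ((V ** diag d ** ctranspose V) *v cnj_vec z))" for z
  proof -
    have "(norm z)\<^sup>2 = (\<Sum>l\<in>UNIV. (cmod (z $ l))\<^sup>2)"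
      by (simp add: norm_vec_def L2_set_def sum_nonneg)
    also have "\<dots> = Re (scalar_product z (mat 1 *v cnj_vec z))"
      by (simp add: scalar_product_def cnj_vec_def complex_norm_square[symmetric] cmod_power2 power2_eq_square)
    \<comment> \<open>The norm is the case of constant weights 1, so the same formula expresses it
      in the diagonalising coordinates.\<close>
    also have "mat 1 = V ** diag (\<lambda>_. 1) ** ctranspose V"
      by (simp add: diag_one V)
    finally have "(norm z)\<^sup>2 = (\<Sum>l\<in>UNIV. (cmod ((transpose V *v z) $ l))\<^sup>2)"
      unfolding Re_hermitian_form_diag by simp
    then have "c * (norm z)\<^sup>2 = (\<Sum>l\<in>UNIV. c * (cmod ((transpose V *v z) $ l))\<^sup>2)"
      by (simp add: sum_distrib_left)
    also have "\<dots> \<le> (\<Sum>l\<in>UNIV. d l * (cmod ((transpose V *v z) $ l))\<^sup>2)"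
      by (intro sum_mono mult_right_mono d) simp
    finally show ?thesis unfolding Re_hermitian_form_diag .
  qed
  with c show ?thesis by (auto simp: coercive_def)
qed

section \<open>Block structure of the unitary matrix X and symmetry of the conjugated
  products\<close>

lemma unitary_intertwine_diag:
  assumes X: "unitary X" and d: "\<And>i. 0 < d i" and sym: "transpose X ** diag d = diag d ** X"
    and nz: "X $ i $ j \<noteq> 0"
  shows "d i = d j"
proof -
  let ?Y = "transpose (ctranspose X)" and ?D = "diag d"
  have 1: "X ** ctranspose X = mat 1" using X by (simp add: unitary_def)
  have "?Y ** transpose X = transpose (X ** ctranspose X)" by (simp only: matrix_transpose_mul)
  then have 2: "?Y ** transpose X = mat 1" by (simp add: 1)
  have 3: "ctranspose X ** ?D = ?D ** ?Y"
    using arg_cong[OF sym, of "\<lambda>M. ctranspose (transpose M)"]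
    by (simp add: matrix_transpose_mul ctranspose_mult ctranspose_transpose)
  \<comment> \<open>Inserting X ctranspose X = 1 between the two copies of D lets the hypothesis act
    on D X and its conjugate transpose on ctranspose X D. Hence squares appear; positivity of d
    removes them at the end.\<close>
  have "?Y ** ?D ** ?D = ?Y ** (?D ** X) ** (ctranspose X ** ?D)"
    by (metis 1 matrix_mul_assoc matrix_mul_rid)
  also have "\<dots> = (?Y ** transpose X) ** ?D ** ?D ** ?Y"
    by (simp only: sym[symmetric] 3 matrix_mul_assoc)
  also have "\<dots> = ?D ** (?D ** ?Y)"
    by (simp add: 2 matrix_mul_assoc)
  finally have "(?Y ** ?D ** ?D) $ i $ j = (?D ** (?D ** ?Y)) $ i $ j" by simp
  then have "(complex_of_real (d j))\<^sup>2 = (complex_of_real (d i))\<^sup>2"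
    using nz by (simp add: diag_mult_nth mult_diag_nth transpose_def ctranspose_def power2_eq_square)
  then have "(d i)\<^sup>2 = (d j)\<^sup>2" by (metis of_real_eq_iff of_real_power)
  then show ?thesis using d[of i] d[of j] by (simp add: power2_eq_iff)
qed

text \<open>The inner entries are d_i X_ij e_j, and the weights d_i e_j and d_j e_i agree wherever
  X_ij is nonzero. It serves both R + Q and R - S.\<close>

lemma conjugated_diag_symmetric:
  assumes "\<And>i j. X $ i $ j = X $ j $ i" "\<And>i j. X $ i $ j \<noteq> 0 \<Longrightarrow> d i = d j \<and> e i = e j"
  shows "transpose (U ** diag d ** X ** diag e ** transpose U) = U ** diag d ** X ** diag e ** transpose U"
proof -
  have "transpose (diag d ** X ** diag e) = diag d ** X ** diag e"
    unfolding transpose_eq_iff mult_diag_nth diag_mult_nth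
  proof (intro allI)
    fix i j
    show "d i * X $ i $ j * e j = d j * X $ j $ i * e i"
      using assms(1)[of i j] assms(2)[of i j] by (cases "X $ i $ j = 0") auto
  qed
  then show ?thesis
    by (simp add: matrix_transpose_mul matrix_mul_assoc)
qed

section \<open>Conjugation to the principal part\<close>

text \<open>A simulation principle for ordered products. It allows the conjugation identity to be
  carried along with an invariant that each single factor requires.\<close>

lemma op_power_rel:
  assumes "\<And>i F G. r F G \<Longrightarrow> r (T i F) (T' i G)" and "r F G"
  shows "r (op_power T \<alpha> F) (op_power T' \<alpha> G)"
proof -
  have *: "r ((T i ^^ m) F) ((T' i ^^ m) G)" if "r F G" for i m F G
    using that by (induction m) (auto intro: assms(1))
  have "r (foldr (\<lambda>i G. (T i ^^ \<alpha> i) G) xs F) (foldr (\<lambda>i G. (T' i ^^ \<alpha> i) G) xs G)" for xs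
    by (induction xs) (auto intro: * assms(2))
  then show ?thesis by (simp add: op_power_def)
qed

lemma op_power_0: "op_power T (\<lambda>_. 0) F = F"
proof -
  have "foldr (\<lambda>i G. (T i ^^ 0) G) xs F = F" for xs
    by (induction xs) auto
  then show ?thesis by (simp add: op_power_def)
qed

lemma scalar_product_add_matrix:
  "scalar_product z ((M + N) *v z) = scalar_product z (M *v z) + scalar_product z (N *v (z::complex^'n))"
  by (simp add: scalar_product_def matrix_vector_mult_add_rdistrib distrib_left sum.distrib)

text \<open>Product rule: each \<open>pd k\<close> on the Gaussian factor contributes - 2 (S z)_k,
  and these sum to the linear form with coefficients - 2 times row i of M S. The scalar c admits
  both \<open>psi_tilde0\<close> and its normalised multiple.\<close>

lemma Xi_conjugation:
  fixes P Q R S :: "complex^'n^'n"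
  assumes S: "transpose S = S" and F: "entire F"
  defines "M \<equiv> ctranspose (R + Q) ** matrix_inv P"
  shows "Xi P R Q i (\<lambda>w. c * exp (- scalar_product w (S *v w)) * F w)
    = (\<lambda>z. c * exp (- scalar_product z (S *v z)) * first_order_op (M $ i) (- 2 *s ((M ** S) $ i)) 0 F z)"
proof
  fix z
  have ent: "entire (\<lambda>w. scalar_product w (S *v w))"
    by (intro polyfun_entire polyfun_quadratic)
  have ent': "entire (\<lambda>w. exp (- scalar_product w (S *v w)))"
    using entire_exp[OF entire_cmult[OF ent, of "- 1"]] by simp
  have pe: "pd k (\<lambda>w. exp (- scalar_product w (S *v w))) z = - 2 * (S *v z) $ k * exp (- scalar_product z (S *v z))" for k
    using pd_exp[OF entire_cmult[OF ent, of "- 1"]] pd_cmult[OF ent, of k "- 1"] pd_quadratic[OF S] by simp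
  have "(\<Sum>k\<in>UNIV. M $ i $ k * (S *v z) $ k) = (\<Sum>j\<in>UNIV. (M ** S) $ i $ j * z $ j)"
  proof -
    have "(M *v (S *v z)) $ i = ((M ** S) *v z) $ i" by (simp only: matrix_vector_mul_assoc)
    then show ?thesis by (simp only: matrix_vector_mult_def vec_lambda_beta)
  qed
  then have eq: "(\<Sum>j\<in>UNIV. (- 2 *s ((M ** S) $ i)) $ j * z $ j) = - 2 * (\<Sum>k\<in>UNIV. M $ i $ k * (S *v z) $ k)"
    by (simp add: sum_distrib_left mult.assoc)
  have "Xi P R Q i (\<lambda>w. c * exp (- scalar_product w (S *v w)) * F w) z
      = (\<Sum>k\<in>UNIV. M $ i $ k * (c * (- 2 * (S *v z) $ k * exp (- scalar_product z (S *v z)) * F z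
            + exp (- scalar_product z (S *v z)) * pd k F z)))"
    unfolding Xi_def M_def[symmetric]
    by (simp only: mult.assoc[of c] pd_cmult[OF entire_mult[OF ent' F]] pd_mult[OF ent' F] pe)
  also have "\<dots> = c * exp (- scalar_product z (S *v z)) * first_order_op (M $ i) (- 2 *s ((M ** S) $ i)) 0 F z"
    unfolding first_order_op_def eq
    by (simp add: sum_distrib_left sum_distrib_right sum.distrib[symmetric] algebra_simps)
  finally show "Xi P R Q i (\<lambda>w. c * exp (- scalar_product w (S *v w)) * F w) z = \<dots>" .
qed

lemma op_power_Xi_conjugation:
  assumes S: "transpose S = S"
    and T: "\<And>i. adjoint_op \<phi> (Lambda Q i)
      = first_order_op ((ctranspose (R + Q) ** matrix_inv P) $ i)
          (- 2 *s ((ctranspose (R + Q) ** matrix_inv P ** S) $ i)) 0"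
  shows "op_power (Xi P R Q) \<alpha> (\<lambda>w. c * exp (- scalar_product w (S *v w)) * psi_tilde0 Q w)
    = (\<lambda>z. c * exp (- scalar_product z (S *v z)) * psi_tilde \<phi> Q \<alpha> z)"
proof -
  let ?q = "\<lambda>z. - scalar_product z (Q *v z)"
  \<comment> \<open>Membership in \<open>poly_exp\<close> travels with the identity, since
    \<open>Xi_conjugation\<close> applies only to entire functions.\<close>
  let ?r = "\<lambda>F G. F \<in> poly_exp ?q \<and> G = (\<lambda>w. c * exp (- scalar_product w (S *v w)) * F w)"
  have q: "?q \<in> polyfun"
    using polyfun.mult[OF polyfun.const[of "- 1"] polyfun_quadratic[of Q]] by simp
  have "?r (op_power (\<lambda>i. adjoint_op \<phi> (Lambda Q i)) \<alpha> (psi_tilde0 Q))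
    (op_power (Xi P R Q) \<alpha> (\<lambda>w. c * exp (- scalar_product w (S *v w)) * psi_tilde0 Q w))"
  proof (rule op_power_rel[where r="?r"])
    have "psi_tilde0 Q \<in> poly_exp ?q"
      unfolding psi_tilde0_def[abs_def] by (rule exp_in_poly_exp)
    then show "?r (psi_tilde0 Q) (\<lambda>w. c * exp (- scalar_product w (S *v w)) * psi_tilde0 Q w)"
      by simp
  next
    fix i F G assume "?r F G"
    then show "?r (adjoint_op \<phi> (Lambda Q i) F) (Xi P R Q i G)"
      unfolding T using poly_exp_first_order_op[OF q] poly_exp_entire[OF q] Xi_conjugation[OF S] by simp
  qed
  then show ?thesis by (simp add: psi_tilde_def)
qed

lemma psi_formulas:
  assumes S: "transpose S = S"
    and T: "\<And>i. adjoint_op \<phi> (Lambda Q i)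
      = first_order_op ((ctranspose (R + Q) ** matrix_inv P) $ i)
          (- 2 *s ((ctranspose (R + Q) ** matrix_inv P ** S) $ i)) 0"
  shows "psi_tilde \<phi> Q \<alpha> z
      = exp (scalar_product z (S *v z))
          * op_power (Xi P R Q) \<alpha> (\<lambda>w. exp (- scalar_product w ((S + Q) *v w))) z" (is "?a = ?s * ?b")
    and "psi_tilde \<phi> Q \<alpha> z
      = exp (scalar_product z (S *v z))
          * op_power (Xi P R Q) \<alpha> (\<lambda>w. exp (- scalar_product w (S *v w)) * psi_tilde0 Q w) z"
    and "psi \<phi> Q \<rho> \<alpha> z
      = exp (scalar_product z (S *v z))
          / complex_of_real (normalizer \<rho> \<alpha> * H_norm \<phi> (psi_tilde0 Q))
          * op_power (Xi P R Q) \<alpha> (\<lambda>w. exp (- scalar_product w ((S + Q) *v w))) z"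
    and "psi \<phi> Q \<rho> \<alpha> z
      = exp (scalar_product z (S *v z))
          / complex_of_real (normalizer \<rho> \<alpha>)
          * op_power (Xi P R Q) \<alpha> (\<lambda>w. exp (- scalar_product w (S *v w)) * psi \<phi> Q \<rho> (\<lambda>_. 0) w) z"
proof -
  note conj = op_power_Xi_conjugation[OF S T]
  have e: "exp (scalar_product z (S *v z)) * exp (- scalar_product z (S *v z)) = 1"
    by (simp flip: exp_add)
  show 2: "psi_tilde \<phi> Q \<alpha> z = exp (scalar_product z (S *v z))
      * op_power (Xi P R Q) \<alpha> (\<lambda>w. exp (- scalar_product w (S *v w)) * psi_tilde0 Q w) z"
    using conj[of \<alpha> 1] e by (simp flip: mult.assoc)
  have "(\<lambda>w. exp (- scalar_product w ((S + Q) *v w))) = (\<lambda>w. exp (- scalar_product w (S *v w)) * psi_tilde0 Q w)"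
    by (simp add: psi_tilde0_def scalar_product_add_matrix flip: exp_add)
  with 2 show 1: "?a = ?s * ?b" by simp
  from 1 show "psi \<phi> Q \<rho> \<alpha> z = ?s / complex_of_real (normalizer \<rho> \<alpha> * H_norm \<phi> (psi_tilde0 Q)) * ?b"
    by (simp add: psi_def)
  \<comment> \<open>\<open>psi\<close> at index 0 already contains the division by the norm, which
    is pulled out as this scalar; only \<open>normalizer\<close> remains in front.\<close>
  define c where "c = inverse (complex_of_real (H_norm \<phi> (psi_tilde0 Q)))"
  have "psi_tilde \<phi> Q (\<lambda>_. 0) = psi_tilde0 Q"
    by (simp add: psi_tilde_def op_power_0)
  then have "(\<lambda>w. exp (- scalar_product w (S *v w)) * psi \<phi> Q \<rho> (\<lambda>_. 0) w)
      = (\<lambda>w. c * exp (- scalar_product w (S *v w)) * psi_tilde0 Q w)"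
    by (simp add: psi_def normalizer_def c_def field_class.field_divide_inverse mult_ac)
  with conj[of \<alpha> c] e show "psi \<phi> Q \<rho> \<alpha> z = ?s / complex_of_real (normalizer \<rho> \<alpha>)
      * op_power (Xi P R Q) \<alpha> (\<lambda>w. exp (- scalar_product w (S *v w)) * psi \<phi> Q \<rho> (\<lambda>_. 0) w) z"
    by (simp add: psi_def c_def field_class.field_divide_inverse)
qed

theorem theorem9:
  fixes A B C U X :: "complex^'n::{finite,linorder}^'n::_"
    and lam :: "'n \<Rightarrow> real" and \<rho> :: real
  defines "\<phi> \<equiv> Phi A B C"
    and "P \<equiv> Phi_zzbar B C"
    and "R \<equiv> Phi_zz A B C"
    and "\<mu> \<equiv> (\<lambda>i. sqrt ((lam i)\<^sup>2 - \<rho>\<^sup>2))"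
  defines "Q \<equiv> - R + U ** diag \<mu> ** X ** diag lam ** transpose U"
    and "S \<equiv> R - U ** diag (\<lambda>i. (lam i)\<^sup>2 / \<mu> i) ** X ** diag lam ** transpose U"
  assumes "transpose A = A" and "det B \<noteq> 0" and "transpose C = C" and "pos_def (im_part C)"
    and "\<And>i. 0 < lam i" and "unitary U"
    and "ctranspose U ** P ** U = diag (\<lambda>i. (lam i)\<^sup>2)"
    and "0 < \<rho>" and "\<rho> < Min (range lam)"
    and "unitary X"
    and "transpose X ** diag (\<lambda>i. \<mu> i / lam i) = diag (\<lambda>i. \<mu> i / lam i) ** X"
  shows "transpose S = S \<and>
    (\<forall>\<alpha> z.
      psi_tilde \<phi> Q \<alpha> z
        = exp (scalar_product z (S *v z))
            * op_power (Xi P R Q) \<alpha> (\<lambda>w. exp (- scalar_product w ((S + Q) *v w))) z \<and>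
      psi_tilde \<phi> Q \<alpha> z
        = exp (scalar_product z (S *v z))
            * op_power (Xi P R Q) \<alpha>
                (\<lambda>w. exp (- scalar_product w (S *v w)) * psi_tilde0 Q w) z \<and>
      psi \<phi> Q \<rho> \<alpha> z
        = exp (scalar_product z (S *v z))
            / complex_of_real (normalizer \<rho> \<alpha> * H_norm \<phi> (psi_tilde0 Q))
            * op_power (Xi P R Q) \<alpha> (\<lambda>w. exp (- scalar_product w ((S + Q) *v w))) z \<and>
      psi \<phi> Q \<rho> \<alpha> z
        = exp (scalar_product z (S *v z))
            / complex_of_real (normalizer \<rho> \<alpha>)
            * op_power (Xi P R Q) \<alpha>
                (\<lambda>w. exp (- scalar_product w (S *v w)) * psi \<phi> Q \<rho> (\<lambda>_. 0) w) z)"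
proof -
  let ?D2 = "diag (\<lambda>i. (lam i)\<^sup>2)"
  note lam = \<open>\<And>i. 0 < lam i\<close>
  have \<rho>_lam: "\<rho> < lam i" for i
    using \<open>\<rho> < Min (range lam)\<close> by simp
  have \<mu>: "0 < \<mu> i" "(\<mu> i)\<^sup>2 = (lam i)\<^sup>2 - \<rho>\<^sup>2" for i
  proof -
    have "\<rho>\<^sup>2 < (lam i)\<^sup>2"
      using \<rho>_lam[of i] \<open>0 < \<rho>\<close> by (intro power_strict_mono) auto
    then show "0 < \<mu> i" "(\<mu> i)\<^sup>2 = (lam i)\<^sup>2 - \<rho>\<^sup>2" by (auto simp: \<mu>_def)
  qed
  \<comment> \<open>The square of mu / lam is 1 - \<rho>^2 / lam^2, which determines the positive
    lam because \<rho> is nonzero.\<close>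
  have lam_eq: "lam i = lam j" if "X $ i $ j \<noteq> 0" for i j
  proof -
    have "\<mu> i / lam i = \<mu> j / lam j"
      using \<open>unitary X\<close> _ \<open>transpose X ** _ = _\<close> that
      by (rule unitary_intertwine_diag) (use \<mu> lam in simp)
    then have "(\<mu> i)\<^sup>2 / (lam i)\<^sup>2 = (\<mu> j)\<^sup>2 / (lam j)\<^sup>2" by (metis power_divide)
    then have "(lam i)\<^sup>2 = (lam j)\<^sup>2"
      using lam[of i] lam[of j] \<open>0 < \<rho>\<close> by (simp add: \<mu> field_simps)
    then show ?thesis using lam[of i] lam[of j] by (simp add: power2_eq_iff)
  qed
  then have \<mu>_eq: "\<mu> i = \<mu> j" if "X $ i $ j \<noteq> 0" for i j
    using that by (simp add: \<mu>_def)
  \<comment> \<open>In entries the hypothesis is X_ji r_j = r_i X_ij with r = mu / lam nonzero. A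
    zero entry has a zero mirror entry; at a nonzero one r_i = r_j cancels.\<close>
  have X_sym: "X $ i $ j = X $ j $ i" for i j
  proof -
    have d: "X $ l $ k * complex_of_real (\<mu> l / lam l) = complex_of_real (\<mu> k / lam k) * X $ k $ l" for k l
      using arg_cong[OF \<open>transpose X ** _ = _\<close>, of "\<lambda>M. M $ k $ l"]
      by (simp only: mult_diag_nth diag_mult_nth) (simp add: transpose_def)
    have nz: "complex_of_real (\<mu> k / lam k) \<noteq> 0" for k
      using \<mu>(1)[of k] lam[of k] by simp
    show ?thesis
    proof (cases "X $ i $ j = 0")
      case True
      then show ?thesis using d[of i j] nz by simp
    next
      case False
      then show ?thesis using d[of i j] nz[of i] lam_eq[OF False] \<mu>_eq[OF False] by simp
    qed
  qed
  have UU: "U ** ctranspose U = mat 1" "ctranspose U ** U = mat 1"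
    and XX: "ctranspose X ** X = mat 1"
    using \<open>unitary U\<close> \<open>unitary X\<close> by (auto simp: unitary_def)
  have P_eq: "P = U ** ?D2 ** ctranspose U"
  proof -
    have "U ** ?D2 ** ctranspose U = U ** (ctranspose U ** P ** U) ** ctranspose U"
      using \<open>ctranspose U ** P ** U = _\<close> by simp
    also have "\<dots> = (U ** ctranspose U) ** P ** (U ** ctranspose U)"
      by (simp only: matrix_mul_assoc)
    finally show ?thesis by (simp add: UU)
  qed
  have P_herm: "ctranspose P = P"
    by (simp add: P_eq ctranspose_mult matrix_mul_assoc)
  have coercive: "coercive P"
    unfolding P_eq
  proof (rule coercive_unitary_diag[OF UU(1)])
    \<comment> \<open>A uniform lower bound for the eigenvalues is at hand: \<rho> lies below every
      \<open>lam l\<close>.\<close>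
    show "\<rho>\<^sup>2 \<le> (lam l)\<^sup>2" for l
      using \<rho>_lam[of l] \<open>0 < \<rho>\<close> by (intro power_mono) auto
    show "0 < \<rho>\<^sup>2" using \<open>0 < \<rho>\<close> by simp
  qed
  let ?L = "diag (\<lambda>i. inverse ((lam i)\<^sup>2))"
  have "P ** (U ** ?L ** ctranspose U) = U ** (?D2 ** (ctranspose U ** U) ** ?L) ** ctranspose U"
    unfolding P_eq by (simp only: matrix_mul_assoc)
  also have "\<dots> = mat 1"
    using lam by (simp add: UU diag_mult_diag diag_one less_imp_neq[symmetric])
  finally have P_inv: "P ** (U ** ?L ** ctranspose U) = mat 1" .
  then have "invertible P"
    unfolding invertible_right_inverse by blast
  note inv = matrix_inv_inverse[OF this]
  have inv_eq: "matrix_inv P = U ** ?L ** ctranspose U"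
    using P_inv inv(2) by (metis matrix_mul_assoc matrix_mul_lid matrix_mul_rid)

  have R_sym: "transpose R = R"
    unfolding R_def using \<open>transpose A = A\<close> \<open>transpose C = C\<close> \<open>pos_def (im_part C)\<close>
    by (rule Phi_zz_symmetric)
  define L where "L = U ** diag (\<lambda>i. (lam i)\<^sup>2 / \<mu> i) ** X ** diag lam ** transpose U"
  have RQ: "R + Q = U ** diag \<mu> ** X ** diag lam ** transpose U"
    by (simp add: Q_def)
  have RQ_sym: "transpose (R + Q) = R + Q"
    unfolding RQ by (rule conjugated_diag_symmetric[OF X_sym]) (use lam_eq \<mu>_eq in blast)
  have L_sym: "transpose L = L"
    unfolding L_def by (rule conjugated_diag_symmetric[OF X_sym]) (use lam_eq \<mu>_eq in metis)
  have S_eq: "S = R - L" by (simp add: S_def L_def)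
  have S_sym: "transpose S = S"
    using R_sym L_sym by (simp add: S_eq transpose_eq_iff)

  let ?M = "ctranspose (R + Q) ** matrix_inv P"
  let ?V = "transpose (ctranspose U)"
  have cRQ: "ctranspose (R + Q) = ?V ** diag lam ** ctranspose X ** diag \<mu> ** ctranspose U"
    by (simp add: RQ ctranspose_mult ctranspose_transpose matrix_mul_assoc)
  have "?M ** L = ?V ** diag lam ** ctranspose X ** (diag \<mu> ** (ctranspose U ** U) ** ?L ** (ctranspose U ** U)
      ** diag (\<lambda>i. (lam i)\<^sup>2 / \<mu> i)) ** X ** diag lam ** transpose U"
    unfolding cRQ inv_eq L_def by (simp only: matrix_mul_assoc)
  also have "diag \<mu> ** (ctranspose U ** U) ** ?L ** (ctranspose U ** U) ** diag (\<lambda>i. (lam i)\<^sup>2 / \<mu> i) = mat 1"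
    using lam \<mu>(1) by (simp add: UU diag_mult_diag diag_one less_imp_neq[symmetric])
  also have "?V ** diag lam ** ctranspose X ** mat 1 ** X ** diag lam ** transpose U
      = ?V ** (diag lam ** (ctranspose X ** X) ** diag lam) ** transpose U"
    by (simp add: matrix_mul_assoc)
  also have "\<dots> = ?V ** ?D2 ** transpose U"
    by (simp add: XX diag_mult_diag power2_eq_square)
  also have "\<dots> = transpose P"
    by (simp add: P_eq matrix_transpose_mul matrix_mul_assoc)
  finally have M_L: "?M ** L = transpose P" .
  have M_P: "?M ** P = ctranspose (R + Q)"
    by (simp add: inv flip: matrix_mul_assoc)

  have \<phi>_eq: "\<phi> = quad_weight P R"
    by (simp add: fun_eq_iff \<phi>_def P_def R_def Phi_def quad_weight_def)
  have adj: "adjoint_op \<phi> (Lambda Q i) = first_order_op (?M $ i) (- 2 *s ((?M ** S) $ i)) 0" for i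
    unfolding \<phi>_eq
  proof (rule adjoint_op_Lambda[OF P_herm R_sym coercive])
    fix j
    have "(\<Sum>k\<in>UNIV. ?M $ i $ k * P $ k $ j) = (?M ** P) $ i $ j"
      by (simp only: matrix_matrix_mult_def vec_lambda_beta)
    also have "\<dots> = cnj ((R + Q) $ j $ i)"
      unfolding M_P by (simp add: ctranspose_def)
    \<comment> \<open>\<open>M_P\<close> yields the entry (j, i), whereas the adjoint needs (i, j);
      symmetry of R + Q, hence of Q, bridges this.\<close>
    finally show "(\<Sum>k\<in>UNIV. ?M $ i $ k * P $ k $ j) = cnj ((R + Q) $ i $ j)"
      using RQ_sym by (simp only: transpose_eq_iff)
    \<comment> \<open>Subtracting \<open>M_L\<close> turns the linear part 2 cnj (P_ij) - 2 (M R)_ij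
      of the adjoint into - 2 (M S)_ij, the form produced by the conjugation.\<close>
    have "?M ** R = ?M ** S + transpose P"
      by (simp add: M_L[symmetric] S_eq flip: matrix_add_ldistrib)
    then have "(?M ** S) $ i $ j = (?M ** R) $ i $ j - P $ j $ i"
      by (simp add: transpose_def)
    moreover have "P $ j $ i = cnj (P $ i $ j)"
      using arg_cong[OF P_herm, of "\<lambda>M. M $ j $ i"] by (simp add: ctranspose_def)
    moreover have "(?M ** R) $ i $ j = (\<Sum>k\<in>UNIV. ?M $ i $ k * R $ k $ j)"
      by (simp only: matrix_matrix_mult_def vec_lambda_beta)
    ultimately have "(?M ** S) $ i $ j = (\<Sum>k\<in>UNIV. ?M $ i $ k * R $ k $ j) - cnj (P $ i $ j)"
      by (simp only:)
    then show "(- 2 *s ((?M ** S) $ i)) $ j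
        = 2 * cnj (P $ i $ j) - 2 * (\<Sum>k\<in>UNIV. ?M $ i $ k * R $ k $ j)"
      by (simp only: vector_smult_component) (simp add: right_diff_distrib)
  qed
  show ?thesis
    using S_sym psi_formulas[OF S_sym adj] by blast
qed

end
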